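(* Assume exactness and $\mathbf{A}\neq0$. Let $x^0,x^1\in\mathbb{R}^n$ satisfy $x^0-x^1\in\mathrm{Range}(\mathbf{B}^{-1}\mathbf{A}^\top)$, and let $\{x^k\}$ be generated by $$x^{k+1}=x^k-\omega\nabla f_{\mathbf{S}_k}(x^k)+\beta(x^k-x^{k-1}),\qquad k\ge1,$$ with $0<\omega\le 1/\lambda_{\max}$ and $(1-\sqrt{\omega\lambda_{\min}^+})^2<\beta<1$. Let $x^*=\Pi_{\mathcal{L},\mathbf{B}}(x^0)$. Then there is a constant $C>0$ such that $$\big\|\mathbb{E}[x^k-x^*]\big\|_{\mathbf{B}}^2\le\beta^k C\qquad\text{for all }k\ge0.$$ In particular, the hypotheses on $(\omega,\beta)$ (and hence this bound) hold for (i) $\omega=1$, $\beta=(1-\sqrt{0.99\,\lambda_{\min}^+})^2$, and for (ii) $\omega=1/\lambda_{\max}$, $\beta=\big(1-\sqrt{0.99\,\lambda_{\min}^+/\lambda_{\max}}\big)^2$.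
   Context: Let $\mathbf{A}\in\mathbb{R}^{m\times n}$ and $b\in\mathbb{R}^m$ be such that the linear system $\mathbf{A}x=b$ is consistent, and let $\mathcal{L}=\{x\in\mathbb{R}^n:\mathbf{A}x=b\}$. Let $\mathbf{B}\in\mathbb{R}^{n\times n}$ be symmetric positive definite, $\langle x,y\rangle_{\mathbf{B}}=x^\top\mathbf{B}y$, $\|x\|_{\mathbf{B}}=\sqrt{x^\top\mathbf{B}x}$, and $\Pi_{\mathcal{L},\mathbf{B}}(x)=\arg\min_{x'\in\mathcal{L}}\|x'-x\|_{\mathbf{B}}$. Let $\mathcal{D}$ be a probability distribution over random real matrices $\mathbf{S}$ with $m$ rows (any number of columns). For $\mathbf{S}\sim\mathcal{D}$ set $\mathbf{H}=\mathbf{S}(\mathbf{S}^\top\mathbf{A}\mathbf{B}^{-1}\mathbf{A}^\top\mathbf{S})^\dagger\mathbf{S}^\top$ ($\dagger$ denotes the Moore–Penrose pseudoinverse) and $\mathbf{Z}=\mathbf{A}^\top\mathbf{H}\mathbf{A}$; $\mathbb{E}[\mathbf{Z}]$ is assumed finite. Define $f_{\mathbf{S}}(x)=\tfrac12(\mathbf{A}x-b)^\top\mathbf{H}(\mathbf{A}x-b)$ and $\nabla f_{\mathbf{S}}(x)=\mathbf{B}^{-1}\mathbf{A}^\top\mathbf{H}(\mathbf{A}x-b)$ (the gradient of $f_{\mathbf{S}}$ with respect to $\langle\cdot,\cdot\rangle_{\mathbf{B}}$). Let $\mathbf{W}=\mathbf{B}^{-1/2}\mathbb{E}[\mathbf{Z}]\mathbf{B}^{-1/2}$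 (its eigenvalues lie in $[0,1]$); $\lambda_{\max}$ is its largest eigenvalue and $\lambda_{\min}^+$ its smallest nonzero eigenvalue. Exactness means $\mathrm{Null}(\mathbb{E}[\mathbf{Z}])=\mathrm{Null}(\mathbf{A})$. The matrices $\mathbf{S}_k$ are drawn i.i.d. from $\mathcal{D}$, independently of everything else. *)

theory Defs
  imports "HOL-Probability.Probability" "Jordan_Normal_Form.Matrix_Kernel" "Jordan_Normal_Form.Char_Poly"
begin

definition mat_inv :: "real mat \<Rightarrow> real mat" where
  "mat_inv X = (THE Y. Y \<in> carrier_mat (dim_row X) (dim_row X) \<and>
      X * Y = 1\<^sub>m (dim_row X) \<and> Y * X = 1\<^sub>m (dim_row X))"

definition pinv :: "real mat \<Rightarrow> real mat" where
  "pinv X = (THE Y. Y \<in> carrier_mat (dim_col X) (dim_row X) \<and>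
      X * Y * X = X \<and> Y * X * Y = Y \<and>
      transpose_mat (X * Y) = X * Y \<and> transpose_mat (Y * X) = Y * X)"

definition sym_mat :: "real mat \<Rightarrow> bool" where
  "sym_mat X \<longleftrightarrow> square_mat X \<and> transpose_mat X = X"

definition pos_def :: "real mat \<Rightarrow> bool" where
  "pos_def X \<longleftrightarrow> sym_mat X \<and>
     (\<forall>v \<in> carrier_vec (dim_row X). v \<noteq> 0\<^sub>v (dim_row X) \<longrightarrow> v \<bullet> (X *\<^sub>v v) > 0)"

definition pos_semidef :: "real mat \<Rightarrow> bool" where
  "pos_semidef X \<longleftrightarrow> sym_mat X \<and>
     (\<forall>v \<in> carrier_vec (dim_row X). v \<bullet> (X *\<^sub>v v) \<ge> 0)"

definition psd_sqrt :: "real mat \<Rightarrow> real mat" where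
  "psd_sqrt X = (THE R. R \<in> carrier_mat (dim_row X) (dim_row X) \<and> pos_semidef R \<and> R * R = X)"

definition B_inner :: "real mat \<Rightarrow> real vec \<Rightarrow> real vec \<Rightarrow> real" where
  "B_inner B x y = x \<bullet> (B *\<^sub>v y)"

definition B_norm :: "real mat \<Rightarrow> real vec \<Rightarrow> real" where
  "B_norm B x = sqrt (B_inner B x x)"

definition sol_set :: "real mat \<Rightarrow> real vec \<Rightarrow> real vec set" where
  "sol_set A b = {x \<in> carrier_vec (dim_col A). A *\<^sub>v x = b}"

definition proj_L :: "real mat \<Rightarrow> real vec \<Rightarrow> real mat \<Rightarrow> real vec \<Rightarrow> real vec" where
  "proj_L A b B x = (THE x'. x' \<in> sol_set A b \<and>
      (\<forall>y \<in> sol_set A b. B_norm B (x' - x) \<le> B_norm B (y - x)))"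

definition H_mat :: "real mat \<Rightarrow> real mat \<Rightarrow> real mat \<Rightarrow> real mat" where
  "H_mat A B S = S * pinv (transpose_mat S * A * mat_inv B * transpose_mat A * S) * transpose_mat S"

definition Z_mat :: "real mat \<Rightarrow> real mat \<Rightarrow> real mat \<Rightarrow> real mat" where
  "Z_mat A B S = transpose_mat A * H_mat A B S * A"

(* gradient of f_S w.r.t. <.,.>_B *)
definition grad_f :: "real mat \<Rightarrow> real vec \<Rightarrow> real mat \<Rightarrow> real mat \<Rightarrow> real vec \<Rightarrow> real vec" where
  "grad_f A b B S x = mat_inv B *\<^sub>v (transpose_mat A *\<^sub>v (H_mat A B S *\<^sub>v (A *\<^sub>v x - b)))"

(* The distribution D of sketches: a probability space D over an abstract sample type 'a,
   together with the random matrix sk :: 'a => real mat.  E[Z] is computed entrywise. *)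
definition EZ :: "real mat \<Rightarrow> real mat \<Rightarrow> 'a measure \<Rightarrow> ('a \<Rightarrow> real mat) \<Rightarrow> real mat" where
  "EZ A B D sk = mat (dim_col A) (dim_col A) (\<lambda>(i,j). \<integral>a. Z_mat A B (sk a) $$ (i,j) \<partial>D)"

definition W_mat :: "real mat \<Rightarrow> real mat \<Rightarrow> 'a measure \<Rightarrow> ('a \<Rightarrow> real mat) \<Rightarrow> real mat" where
  "W_mat A B D sk = psd_sqrt (mat_inv B) * EZ A B D sk * psd_sqrt (mat_inv B)"

definition lambda_max :: "real mat \<Rightarrow> real" where
  "lambda_max W = Max {k. eigenvalue W k}"

definition lambda_min_pos :: "real mat \<Rightarrow> real" where
  "lambda_min_pos W = Min {k. eigenvalue W k \<and> k \<noteq> 0}"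

(* Stochastic heavy ball iterates.  w :: 'a stream is the i.i.d. sequence of samples,
   S_k = sk (w !! k).  x^0, x^1 given; x^{k+1} = x^k - om grad f_{S_k}(x^k) + beta (x^k - x^{k-1}). *)
fun shb :: "real mat \<Rightarrow> real vec \<Rightarrow> real mat \<Rightarrow> ('a \<Rightarrow> real mat) \<Rightarrow> real \<Rightarrow> real
            \<Rightarrow> real vec \<Rightarrow> real vec \<Rightarrow> 'a stream \<Rightarrow> nat \<Rightarrow> real vec" where
  "shb A b B sk om beta x0 x1 w 0 = x0"
| "shb A b B sk om beta x0 x1 w (Suc 0) = x1"
| "shb A b B sk om beta x0 x1 w (Suc (Suc k)) =
     shb A b B sk om beta x0 x1 w (Suc k)
     - om \<cdot>\<^sub>v grad_f A b B (sk (w !! Suc k)) (shb A b B sk om beta x0 x1 w (Suc k))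
     + beta \<cdot>\<^sub>v (shb A b B sk om beta x0 x1 w (Suc k) - shb A b B sk om beta x0 x1 w k)"

definition E_vec :: "'a measure \<Rightarrow> nat \<Rightarrow> ('a stream \<Rightarrow> real vec) \<Rightarrow> real vec" where
  "E_vec D n X = vec n (\<lambda>i. \<integral>w. X w $ i \<partial>(stream_space D))"

definition good_params :: "real \<Rightarrow> real \<Rightarrow> real \<Rightarrow> real \<Rightarrow> bool" where
  "good_params lmax lmin om beta \<longleftrightarrow>
     0 < om \<and> om \<le> 1 / lmax \<and> (1 - sqrt (om * lmin))^2 < beta \<and> beta < 1"

end

theory Submission
  imports Defs
begin

text \<open>
  With \<open>G = B\<^sup>-\<^sup>1\<close> and \<open>R = G\<^sup>1\<^sup>/\<^sup>2\<close>, diagonalize \<open>W = R E[Z] R\<close> by an orthogonal \<open>U\<close> and put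
  \<open>P = R U\<close>. The columns of \<open>P\<close> form a \<open>B\<close>-orthonormal basis in which \<open>G E[Z]\<close> acts as
  \<open>diag d\<close>. From \<open>Z G Z = Z\<close> one gets \<open>0 \<le> Z \<le> B\<close>, hence \<open>0 \<le> d\<^sub>i \<le> 1\<close>. Each sample is
  independent of the preceding iterates, so the expected error follows the deterministic heavy
  ball recursion driven by \<open>G E[Z]\<close>, and its coordinates satisfy
  \<open>u\<^sub>k\<^sub>+\<^sub>2 = (1 + \<beta> - \<omega> d\<^sub>i) u\<^sub>k\<^sub>+\<^sub>1 - \<beta> u\<^sub>k\<close>. If \<open>d\<^sub>i = 0\<close>, exactness and the range condition make
  both initial coordinates vanish. If \<open>d\<^sub>i > 0\<close>, the assumption on \<open>\<beta>\<close> makes the characteristic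
  roots non-real, of modulus \<open>\<surd>\<beta>\<close>.
\<close>

text \<open>Inverse, square root, pseudoinverse and projection are definite descriptions, so
  existence and uniqueness must be settled before anything can be computed with them; the first
  three all rest on one real spectral theorem. The iterates are random, but consistency makes the
  stochastic gradient vanish at every solution, so the error obeys a homogeneous linear recursion
  whose coefficients come from the entries of \<open>G * Z a\<close>. Unrolling it from its first
  sample reduces independence to Fubini on one sample times the remaining stream, without
  conditional expectations. The eigenvalue 0 needs separate treatment because its recursion has
  characteristic roots 1 and beta, so a nonzero coordinate need not decay. For the others, (1 - sqrt
  mu)^2 decreases in mu on [0,1]: the condition at the smallest nonzero eigenvalue covers all of
  them, and om <= 1 / lambda_max keeps every om * d i in that interval. Strictness matters: at
  equality the two roots coincide and a factor growing with k can appear.\<close>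

section \<open>Diagonalization of real symmetric matrices\<close>

lemma scalar_prod_self_eq_sum:
  fixes v :: "real vec"
  assumes "v \<in> carrier_vec n"
  shows "v \<bullet> v = (\<Sum>i<n. (v $ i)\<^sup>2)"
  using assms by (auto simp: scalar_prod_def power2_eq_square atLeast0LessThan)

lemma scalar_prod_self_nonneg: "(v :: real vec) \<bullet> v \<ge> 0"
  by (auto simp: scalar_prod_def intro!: sum_nonneg)

lemma scalar_prod_self_eq_0_iff:
  fixes v :: "real vec"
  assumes "v \<in> carrier_vec n"
  shows "v \<bullet> v = 0 \<longleftrightarrow> v = 0\<^sub>v n"
  unfolding scalar_prod_self_eq_sum[OF assms] using assms
  by (subst sum_nonneg_eq_0_iff) (auto intro!: eq_vecI)

text \<open>The fundamental theorem of algebra supplies a complex eigenpair. Symmetry forces the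
  eigenvalue to be real, and then the real and imaginary parts of the eigenvector satisfy the same
  eigenvalue equation; at least one of them is nonzero.\<close>

lemma symmetric_real_eigenvector:
  fixes M :: "real mat"
  assumes M: "M \<in> carrier_mat n n" and sym: "transpose_mat M = M" and n: "n > 0"
  obtains l v where "v \<in> carrier_vec n" "v \<noteq> 0\<^sub>v n" "M *\<^sub>v v = l \<cdot>\<^sub>v v"
proof -
  let ?C = "map_mat complex_of_real M"
  have C: "?C \<in> carrier_mat n n" using M by auto
  have "degree (char_poly ?C) = n" using degree_monic_char_poly[OF C] by auto
  then obtain z where "poly (char_poly ?C) z = 0"
    using n fundamental_theorem_of_algebra[of "char_poly ?C"] by (auto simp: constant_degree)
  then obtain u where u: "u \<in> carrier_vec n" "u \<noteq> 0\<^sub>v n" "?C *\<^sub>v u = z \<cdot>\<^sub>v u"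
    using eigenvalue_root_char_poly[OF C] C unfolding eigenvalue_def eigenvector_def by auto
  define v where "v = map_vec Re u"
  define w where "w = map_vec Im u"
  have v: "v \<in> carrier_vec n" and w: "w \<in> carrier_vec n" using u by (auto simp: v_def w_def)
  have comp: "(\<Sum>j<n. complex_of_real (M $$ (i,j)) * u $ j) = z * u $ i" if "i < n" for i
    using arg_cong[OF u(3), of "\<lambda>x. x $ i"] that u(1) M
    by (simp add: scalar_prod_def atLeast0LessThan)
  have Mv: "M *\<^sub>v v = Re z \<cdot>\<^sub>v v - Im z \<cdot>\<^sub>v w"
  proof (rule eq_vecI)
    fix i assume "i < dim_vec (Re z \<cdot>\<^sub>v v - Im z \<cdot>\<^sub>v w)"
    then have i: "i < n" using v w by auto
    show "(M *\<^sub>v v) $ i = (Re z \<cdot>\<^sub>v v - Im z \<cdot>\<^sub>v w) $ i"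
      using arg_cong[OF comp[OF i], of Re] i M u(1)
      by (simp add: scalar_prod_def atLeast0LessThan v_def w_def)
  qed (use M v w in auto)
  have Mw: "M *\<^sub>v w = Im z \<cdot>\<^sub>v v + Re z \<cdot>\<^sub>v w"
  proof (rule eq_vecI)
    fix i assume "i < dim_vec (Im z \<cdot>\<^sub>v v + Re z \<cdot>\<^sub>v w)"
    then have i: "i < n" using v w by auto
    show "(M *\<^sub>v w) $ i = (Im z \<cdot>\<^sub>v v + Re z \<cdot>\<^sub>v w) $ i"
      using arg_cong[OF comp[OF i], of Im] i M u(1)
      by (simp add: scalar_prod_def atLeast0LessThan v_def w_def)
  qed (use M v w in auto)
  have vw: "v \<noteq> 0\<^sub>v n \<or> w \<noteq> 0\<^sub>v n"
  proof (rule ccontr)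
    assume *: "\<not> ?thesis"
    have "u = 0\<^sub>v n"
    proof (rule eq_vecI)
      fix i assume i: "i < dim_vec (0\<^sub>v n :: complex vec)"
      have "v $ i = 0" "w $ i = 0" using * i by auto
      then show "u $ i = 0\<^sub>v n $ i" using i u(1) by (auto simp: v_def w_def complex_eq_iff)
    qed (use u in auto)
    with u show False by simp
  qed
  \<comment> \<open>Expanding both sides, the terms with Re z cancel and Im z * (|v|^2 + |w|^2) = 0
    remains.\<close>
  have "w \<bullet> (M *\<^sub>v v) = (M *\<^sub>v w) \<bullet> v"
    using transpose_vec_mult_scalar[OF M v w] sym by simp
  then have "Im z * (v \<bullet> v + w \<bullet> w) = 0"
    unfolding Mv Mw using v w comm_scalar_prod[OF v w]
    by (simp add: scalar_prod_minus_distrib[of _ n] add_scalar_prod_distrib[of _ n] algebra_simps)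
  moreover have "v \<bullet> v + w \<bullet> w \<noteq> 0"
    using vw scalar_prod_self_nonneg[of v] scalar_prod_self_nonneg[of w]
      scalar_prod_self_eq_0_iff[OF v] scalar_prod_self_eq_0_iff[OF w] by linarith
  ultimately have Im: "Im z = 0" by simp
  have "M *\<^sub>v v = Re z \<cdot>\<^sub>v v" "M *\<^sub>v w = Re z \<cdot>\<^sub>v w"
    unfolding Mv Mw Im using v w by (auto intro!: eq_vecI)
  with vw v w that show ?thesis by blast
qed

text \<open>Householder reflection along u - e_0, which swaps the unit vectors u and e_0. Being
  symmetric and its own inverse, it makes conjugation by an orthogonal matrix simply
  \<open>H * M * H\<close>. The case u = e_0 is separate because the direction degenerates.\<close>

lemma reflection_to_first_unit_vec:
  fixes u :: "real vec"
  assumes u: "u \<in> carrier_vec n" and unit: "u \<bullet> u = 1" and n: "n > 0"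
  obtains H where "H \<in> carrier_mat n n" "transpose_mat H = H" "H * H = 1\<^sub>m n"
    "H *\<^sub>v unit_vec n 0 = u"
proof (cases "u = unit_vec n 0")
  case True
  then show ?thesis using that[of "1\<^sub>m n"] u by auto
next
  case False
  define v where "v = u - unit_vec n 0"
  have v: "v \<in> carrier_vec n" using u by (simp add: v_def)
  define s where "s = v \<bullet> v"
  have "v \<noteq> 0\<^sub>v n"
  proof
    assume "v = 0\<^sub>v n"
    have "u $ i = unit_vec n 0 $ i" if "i < n" for i
    proof -
      have "v $ i = 0" using \<open>v = 0\<^sub>v n\<close> that by simp
      then show ?thesis using that u by (simp add: v_def split: if_splits)
    qed
    then have "u = unit_vec n 0" using u by (auto intro!: eq_vecI)
    with False show False by simp
  qed
  then have s0: "s \<noteq> 0" using scalar_prod_self_eq_0_iff[OF v] by (simp add: s_def)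
  \<comment> \<open>Equivalently v_0 = - s / 2, which is exactly what cancels the factor 2 / s when
    H is applied to e_0.\<close>
  have s: "s = 2 - 2 * u $ 0"
    unfolding s_def v_def using u n unit
    by (simp add: minus_scalar_prod_distrib[of _ n] scalar_prod_minus_distrib[of _ n])
  define H where "H = Matrix.mat n n (\<lambda>(i,j). (if i = j then 1 else 0) - 2 / s * v $ i * v $ j)"
  have H: "H \<in> carrier_mat n n" by (simp add: H_def)
  have vv: "(\<Sum>k<n. v $ k * v $ k) = s"
    using scalar_prod_self_eq_sum[OF v] by (simp add: s_def power2_eq_square)
  have "transpose_mat H = H" by (auto simp: H_def intro!: eq_matI)
  moreover have "H * H = 1\<^sub>m n"
  proof (rule eq_matI)
    fix i j assume "i < dim_row (1\<^sub>m n :: real mat)" "j < dim_col (1\<^sub>m n :: real mat)"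
    then have ij: "i < n" "j < n" by auto
    have "(H * H) $$ (i,j) = (\<Sum>k<n. ((if i = k then 1 else 0) - 2 / s * v $ i * v $ k)
            * ((if k = j then 1 else 0) - 2 / s * v $ k * v $ j))"
      using ij by (simp add: H_def scalar_prod_def atLeast0LessThan)
    also have "\<dots> = (\<Sum>k<n. (if i = k then (if k = j then 1 else 0) else 0)
        - (if i = k then 2 / s * v $ k * v $ j else 0) - (if k = j then 2 / s * v $ i * v $ k else 0)
        + 4 / s\<^sup>2 * v $ i * v $ j * (v $ k * v $ k))"
      by (intro sum.cong refl) (auto simp: algebra_simps power2_eq_square)
    also have "\<dots> = (if i = j then 1 else 0) - 4 / s * v $ i * v $ j + 4 / s\<^sup>2 * v $ i * v $ j * s"
    proof -
      have "(\<Sum>k<n. 4 / s\<^sup>2 * v $ i * v $ j * (v $ k * v $ k)) = 4 / s\<^sup>2 * v $ i * v $ j * s"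
        by (simp only: sum_distrib_left[symmetric] vv)
      then show ?thesis using ij by (simp only: sum.distrib sum_subtractf) (simp add: algebra_simps)
    qed
    also have "\<dots> = 1\<^sub>m n $$ (i,j)"
      using ij s0 by (simp add: power2_eq_square)
    finally show "(H * H) $$ (i,j) = 1\<^sub>m n $$ (i,j)" .
  qed (simp_all add: H_def)
  moreover have "H *\<^sub>v unit_vec n 0 = u"
  proof (rule eq_vecI)
    fix i assume "i < dim_vec u"
    then have i: "i < n" using u by auto
    have v0: "v $ 0 = - s / 2" using n u s by (simp add: v_def)
    have "(H *\<^sub>v unit_vec n 0) $ i = H $$ (i,0)"
      using i n H by simp
    also have "\<dots> = (if i = 0 then 1 else 0) - 2 / s * v $ i * v $ 0"
      using i n by (simp add: H_def)
    also have "\<dots> = (if i = 0 then 1 else 0) + v $ i"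
      unfolding v0 using s0 by simp
    also have "\<dots> = u $ i" using i u by (simp add: v_def)
    finally show "(H *\<^sub>v unit_vec n 0) $ i = u $ i" .
  qed (use u H in auto)
  ultimately show ?thesis using that[OF H] by blast
qed

text \<open>Deflation: after a reflection carrying e_0 to a unit eigenvector, e_0 is an eigenvector
  of \<open>N\<close>, so the first column of \<open>N\<close>, and by symmetry its first row, is
  zero off the diagonal. The remaining block is symmetric of size n, and the induction hypothesis
  diagonalizes it.\<close>

theorem symmetric_real_diagonalization:
  fixes M :: "real mat"
  assumes "M \<in> carrier_mat n n" "transpose_mat M = M"
  shows "\<exists>U d. U \<in> carrier_mat n n \<and> transpose_mat U * U = 1\<^sub>m n \<and> U * transpose_mat U = 1\<^sub>m n
    \<and> transpose_mat U * M * U = mat_diag n d"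
  using assms
proof (induction n arbitrary: M)
  case 0
  then show ?case by (intro exI[of _ "1\<^sub>m 0"]) (auto simp: mat_diag_def intro!: eq_matI)
next
  case (Suc n)
  note M = Suc.prems(1) and sym = Suc.prems(2)
  obtain l v where v: "v \<in> carrier_vec (Suc n)" "v \<noteq> 0\<^sub>v (Suc n)" and Mv: "M *\<^sub>v v = l \<cdot>\<^sub>v v"
    using symmetric_real_eigenvector[OF M sym zero_less_Suc] by blast
  have vpos: "v \<bullet> v > 0"
    using scalar_prod_self_nonneg[of v] scalar_prod_self_eq_0_iff[OF v(1)] v(2) by linarith
  define u where "u = (1 / sqrt (v \<bullet> v)) \<cdot>\<^sub>v v"
  have u: "u \<in> carrier_vec (Suc n)" using v by (simp add: u_def)
  have unit: "u \<bullet> u = 1" using vpos v by (simp add: u_def)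
  have Mu: "M *\<^sub>v u = l \<cdot>\<^sub>v u"
    unfolding u_def using M v Mv
    by (simp add: mult_mat_vec[of _ "Suc n" "Suc n"] smult_smult_assoc mult.commute)
  obtain H where H: "H \<in> carrier_mat (Suc n) (Suc n)" and Ht: "transpose_mat H = H"
    and HH: "H * H = 1\<^sub>m (Suc n)" and He: "H *\<^sub>v unit_vec (Suc n) 0 = u"
    using reflection_to_first_unit_vec[OF u unit] by blast
  have Hu: "H *\<^sub>v u = unit_vec (Suc n) 0"
  proof -
    have "H *\<^sub>v u = (H * H) *\<^sub>v unit_vec (Suc n) 0"
      using H He by (simp add: assoc_mult_mat_vec[of _ "Suc n" "Suc n" _ "Suc n"])
    then show ?thesis by (simp add: HH)
  qed
  define N where "N = H * M * H"
  have N: "N \<in> carrier_mat (Suc n) (Suc n)" using H M by (simp add: N_def)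
  have Nt: "transpose_mat N = N"
    using H M by (simp add: N_def transpose_mult[of _ "Suc n" "Suc n" _ "Suc n"] Ht sym
        assoc_mult_mat[of _ "Suc n" "Suc n" _ "Suc n" _ "Suc n"])
  have "N *\<^sub>v unit_vec (Suc n) 0 = H *\<^sub>v (M *\<^sub>v (H *\<^sub>v unit_vec (Suc n) 0))"
    using H M by (simp add: N_def assoc_mult_mat_vec[of _ "Suc n" "Suc n" _ "Suc n"])
  also have "\<dots> = l \<cdot>\<^sub>v unit_vec (Suc n) 0"
    using H u Hu by (simp add: He Mu mult_mat_vec[of _ "Suc n" "Suc n"])
  finally have Ne: "N *\<^sub>v unit_vec (Suc n) 0 = l \<cdot>\<^sub>v unit_vec (Suc n) 0" .
  have Ni0: "N $$ (i,0) = (if i = 0 then l else 0)" if "i < Suc n" for i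
  proof -
    have "N $$ (i,0) = (N *\<^sub>v unit_vec (Suc n) 0) $ i" using N that by simp
    then show ?thesis unfolding Ne using that by simp
  qed
  have N0i: "N $$ (0,i) = (if i = 0 then l else 0)" if "i < Suc n" for i
  proof -
    have "N $$ (0,i) = transpose_mat N $$ (i,0)" using N that by auto
    then show ?thesis using Ni0 that by (simp add: Nt)
  qed
  define K where "K = Matrix.mat n n (\<lambda>(i,j). N $$ (Suc i, Suc j))"
  have K: "K \<in> carrier_mat n n" by (simp add: K_def)
  have Ksym: "transpose_mat K = K"
  proof (rule eq_matI)
    fix i j assume "i < dim_row K" "j < dim_col K"
    then have ij: "i < n" "j < n" by (auto simp: K_def)
    have "N $$ (Suc j, Suc i) = transpose_mat N $$ (Suc i, Suc j)" using N ij by simp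
    with ij show "transpose_mat K $$ (i,j) = K $$ (i,j)" by (simp add: K_def Nt)
  qed (simp_all add: K_def)
  obtain V d where V: "V \<in> carrier_mat n n" and VV: "transpose_mat V * V = 1\<^sub>m n"
    "V * transpose_mat V = 1\<^sub>m n" and Vd: "transpose_mat V * K * V = mat_diag n d"
    using Suc.IH[OF K Ksym] by auto
  define lm where "lm = Matrix.mat 1 1 (\<lambda>_. l)"
  have lm: "lm \<in> carrier_mat 1 1" by (simp add: lm_def)
  have Nblock: "N = four_block_mat lm (0\<^sub>m 1 n) (0\<^sub>m n 1) K"
  proof (rule eq_matI)
    fix i j assume "i < dim_row (four_block_mat lm (0\<^sub>m 1 n) (0\<^sub>m n 1) K)"
      "j < dim_col (four_block_mat lm (0\<^sub>m 1 n) (0\<^sub>m n 1) K)"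
    then have ij: "i < Suc n" "j < Suc n" by (auto simp: lm_def K_def)
    then show "N $$ (i,j) = four_block_mat lm (0\<^sub>m 1 n) (0\<^sub>m n 1) K $$ (i,j)"
      by (cases i; cases j) (auto simp: lm_def K_def Ni0 N0i)
  qed (use N in \<open>auto simp: lm_def K_def\<close>)
  define Q where "Q = four_block_mat (1\<^sub>m 1) (0\<^sub>m 1 n) (0\<^sub>m n 1) V"
  have Q: "Q \<in> carrier_mat (Suc n) (Suc n)"
    using four_block_carrier_mat[of "1\<^sub>m 1" 1 1 V n n] V by (simp add: Q_def)
  have Vt: "transpose_mat V \<in> carrier_mat n n" using V by simp
  have Qt: "transpose_mat Q = four_block_mat (1\<^sub>m 1) (0\<^sub>m 1 n) (0\<^sub>m n 1) (transpose_mat V)"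
    unfolding Q_def using V by (subst transpose_four_block_mat[of _ 1 1 _ n _ n]) auto
  have QtQ: "transpose_mat Q * Q = 1\<^sub>m (Suc n)"
    unfolding Qt unfolding Q_def
    using V Vt by (subst mult_four_block_mat[of _ 1 1 _ n _ n _ _ 1 _ n])
      (auto simp: VV four_block_one_mat[of 1 n, simplified])
  have QQt: "Q * transpose_mat Q = 1\<^sub>m (Suc n)"
    unfolding Qt unfolding Q_def
    using V Vt by (subst mult_four_block_mat[of _ 1 1 _ n _ n _ _ 1 _ n])
      (auto simp: VV four_block_one_mat[of 1 n, simplified])
  have "transpose_mat Q * N = four_block_mat lm (0\<^sub>m 1 n) (0\<^sub>m n 1) (transpose_mat V * K)"
    unfolding Qt Nblock
    using V Vt K lm by (subst mult_four_block_mat[of _ 1 1 _ n _ n _ _ 1 _ n]) auto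
  then have "transpose_mat Q * N * Q = four_block_mat lm (0\<^sub>m 1 n) (0\<^sub>m n 1) (transpose_mat V * K)
      * four_block_mat (1\<^sub>m 1) (0\<^sub>m 1 n) (0\<^sub>m n 1) V"
    by (simp add: Q_def)
  also have "\<dots> = four_block_mat lm (0\<^sub>m 1 n) (0\<^sub>m n 1) (mat_diag n d)"
    unfolding Vd[symmetric]
    using V Vt K lm by (subst mult_four_block_mat[of _ 1 1 _ n _ n _ _ 1 _ n]) auto
  also have "\<dots> = mat_diag (Suc n) (case_nat l d)"
    by (rule eq_matI) (auto simp: mat_diag_def lm_def split: nat.split)
  finally have QNQ: "transpose_mat Q * N * Q = mat_diag (Suc n) (case_nat l d)" .
  define U where "U = H * Q"
  have U: "U \<in> carrier_mat (Suc n) (Suc n)" using H Q by (simp add: U_def)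
  have Ut: "transpose_mat U = transpose_mat Q * H"
    using H Q by (simp add: U_def transpose_mult[of _ "Suc n" "Suc n" _ "Suc n"] Ht)
  note assoc = assoc_mult_mat[of _ "Suc n" "Suc n" _ "Suc n" _ "Suc n"]
  have Qt': "transpose_mat Q \<in> carrier_mat (Suc n) (Suc n)" using Q by simp
  have HHX: "H * (H * X) = X" if "X \<in> carrier_mat (Suc n) (Suc n)" for X
    using that H HH assoc[of H H X] by simp
  have QQX: "Q * (transpose_mat Q * X) = X" if "X \<in> carrier_mat (Suc n) (Suc n)" for X
    using that Q Qt' QQt assoc[of Q "transpose_mat Q" X] by simp
  have "transpose_mat U * U = 1\<^sub>m (Suc n)"
    unfolding Ut unfolding U_def using H Q Qt' by (simp add: assoc HHX QtQ)
  moreover have "U * transpose_mat U = 1\<^sub>m (Suc n)"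
    unfolding Ut unfolding U_def using H Q Qt' by (simp add: assoc QQX HH)
  moreover have "transpose_mat U * M * U = mat_diag (Suc n) (case_nat l d)"
    unfolding Ut unfolding U_def QNQ[symmetric] N_def using H Q Qt' M by (simp add: assoc)
  ultimately show ?case using U by blast
qed

section \<open>Spectral calculus for matrices that are diagonal in an orthonormal basis\<close>

lemma transpose_mat_diag [simp]: "transpose_mat (mat_diag n f) = mat_diag n f"
  by (rule eq_matI) (auto simp: mat_diag_def)

lemma mat_diag_mult_vec_index:
  fixes f :: "nat \<Rightarrow> real"
  assumes "v \<in> carrier_vec n" "i < n"
  shows "(mat_diag n f *\<^sub>v v) $ i = f i * v $ i"
proof -
  have "(mat_diag n f *\<^sub>v v) $ i = (\<Sum>j<n. (if i = j then f j else 0) * v $ j)"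
    using assms by (simp add: mat_diag_def scalar_prod_def atLeast0LessThan)
  also have "\<dots> = (\<Sum>j<n. if i = j then f i * v $ i else 0)"
    by (intro sum.cong) auto
  finally show ?thesis using assms by simp
qed

lemma quadratic_form_col:
  fixes M P :: "real mat"
  assumes "M \<in> carrier_mat n n" "P \<in> carrier_mat n n" "i < n"
  shows "(transpose_mat P * M * P) $$ (i,i) = col P i \<bullet> (M *\<^sub>v col P i)"
proof -
  have "(transpose_mat P * M * P) $$ (i,i) = (transpose_mat P * (M * P)) $$ (i,i)"
    using assms by (simp add: assoc_mult_mat[of _ n n _ n _ n])
  also have "\<dots> = col P i \<bullet> col (M * P) i"
    using assms by simp
  also have "col (M * P) i = M *\<^sub>v col P i"
    using assms by (intro col_mult2[of _ n n _ n]) auto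
  finally show ?thesis .
qed

text \<open>For a fixed orthogonal P this turns matrix algebra into pointwise algebra of f, so that
  inverse, square root and pseudoinverse become reciprocal, \<open>sqrt\<close> and
  \<open>inverse\<close> of the eigenvalues.\<close>

definition diag_conj :: "nat \<Rightarrow> real mat \<Rightarrow> (nat \<Rightarrow> real) \<Rightarrow> real mat" where
  "diag_conj n P f = P * mat_diag n f * transpose_mat P"

lemma diag_conj_carrier [simp]: "P \<in> carrier_mat n n \<Longrightarrow> diag_conj n P f \<in> carrier_mat n n"
  unfolding diag_conj_def by (metis mult_carrier_mat mat_diag_dim transpose_carrier_mat)

lemma diag_conj_dim [simp]:
  "P \<in> carrier_mat n n \<Longrightarrow> dim_row (diag_conj n P f) = n"
  "P \<in> carrier_mat n n \<Longrightarrow> dim_col (diag_conj n P f) = n"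
  by (auto dest: diag_conj_carrier[of _ _ f])

lemma transpose_diag_conj:
  assumes "P \<in> carrier_mat n n"
  shows "transpose_mat (diag_conj n P f) = diag_conj n P f"
proof -
  have D: "mat_diag n f \<in> carrier_mat n n" and "P * mat_diag n f \<in> carrier_mat n n"
    using assms by auto
  then have "transpose_mat (diag_conj n P f) = P * (mat_diag n f * transpose_mat P)"
    unfolding diag_conj_def using assms
    by (simp add: transpose_mult[of "P * mat_diag n f" n n _ n] transpose_mult[of P n n _ n])
  also have "\<dots> = diag_conj n P f"
    unfolding diag_conj_def using assms D by (simp add: assoc_mult_mat[of P n n _ n _ n])
  finally show ?thesis .
qed

lemma diag_conj_mult:
  assumes P: "P \<in> carrier_mat n n" and PP: "transpose_mat P * P = 1\<^sub>m n"
  shows "diag_conj n P f * diag_conj n P g = diag_conj n P (\<lambda>i. f i * g i)"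
proof -
  have Pt: "transpose_mat P \<in> carrier_mat n n" using P by simp
  note D = mat_diag_dim[of n f] mat_diag_dim[of n g]
  note assoc = assoc_mult_mat[of _ n n _ n _ n]
  have "diag_conj n P f * diag_conj n P g
      = P * (mat_diag n f * ((transpose_mat P * P) * (mat_diag n g * transpose_mat P)))"
    unfolding diag_conj_def using P Pt D by (simp add: assoc del: mat_diag_dim)
  also have "\<dots> = P * (mat_diag n f * (mat_diag n g * transpose_mat P))"
    unfolding PP using P Pt D by (simp del: mat_diag_dim)
  also have "\<dots> = P * ((mat_diag n f * mat_diag n g) * transpose_mat P)"
    using P Pt D by (simp add: assoc del: mat_diag_dim mat_diag_diag)
  also have "\<dots> = diag_conj n P (\<lambda>i. f i * g i)"
    unfolding diag_conj_def using P Pt mat_diag_dim[of n "\<lambda>i. f i * g i"]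
    by (simp add: assoc del: mat_diag_dim)
  finally show ?thesis .
qed

lemma diag_conj_col:
  assumes P: "P \<in> carrier_mat n n" and PP: "transpose_mat P * P = 1\<^sub>m n" and i: "i < n"
  shows "diag_conj n P f *\<^sub>v col P i = f i \<cdot>\<^sub>v col P i"
proof -
  have "diag_conj n P f * P = P * mat_diag n f * (transpose_mat P * P)"
    unfolding diag_conj_def using P mat_diag_dim[of n f]
    by (simp add: assoc_mult_mat[of _ n n _ n _ n] del: mat_diag_dim)
  also have "\<dots> = P * mat_diag n f" using P PP mat_diag_dim[of n f] by (simp del: mat_diag_dim)
  finally have "col (diag_conj n P f * P) i = col (P * mat_diag n f) i" by simp
  moreover have "col (P * mat_diag n f) i = f i \<cdot>\<^sub>v col P i"
    using i P by (auto simp: mat_diag_mult_right[OF P] intro!: eq_vecI)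
  ultimately show ?thesis
    using col_mult2[OF diag_conj_carrier[OF P, of f] P i] by (simp only:)
qed

lemma orthogonal_col_nonzero:
  fixes U :: "real mat"
  assumes "U \<in> carrier_mat n n" "transpose_mat U * U = 1\<^sub>m n" "i < n"
  shows "col U i \<noteq> 0\<^sub>v n"
proof -
  have "col U i \<bullet> col U i = (transpose_mat U * U) $$ (i,i)" using assms(1,3) by simp
  also have "\<dots> = 1" using assms(2,3) by simp
  finally show ?thesis by auto
qed

lemma eigenvalues_diag_conj:
  assumes P: "P \<in> carrier_mat n n" and PP: "transpose_mat P * P = 1\<^sub>m n" "P * transpose_mat P = 1\<^sub>m n"
  shows "{k. eigenvalue (diag_conj n P f) k} = f ` {..<n}"
proof (intro equalityI subsetI)
  fix k assume "k \<in> f ` {..<n}"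
  then obtain i where i: "i < n" "k = f i" by auto
  have "eigenvector (diag_conj n P f) (col P i) k"
    unfolding eigenvector_def
    using diag_conj_col[OF P PP(1) i(1)] orthogonal_col_nonzero[OF P PP(1) i(1)] i P by simp
  then show "k \<in> {k. eigenvalue (diag_conj n P f) k}" by (auto simp: eigenvalue_def)
next
  fix k assume "k \<in> {k. eigenvalue (diag_conj n P f) k}"
  then obtain v where v: "v \<in> carrier_vec n" "v \<noteq> 0\<^sub>v n" and
    ev: "diag_conj n P f *\<^sub>v v = k \<cdot>\<^sub>v v"
    using P by (auto simp: eigenvalue_def eigenvector_def)
  have Pt: "transpose_mat P \<in> carrier_mat n n" using P by simp
  have D: "mat_diag n f \<in> carrier_mat n n" by simp
  \<comment> \<open>Coordinates of v in the eigenbasis: the eigenvalue equation becomes k * t_i = f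
    i * t_i for each i, and some t_i is nonzero.\<close>
  define t where "t = transpose_mat P *\<^sub>v v"
  have t: "t \<in> carrier_vec n" using Pt v by (simp add: t_def)
  have "P *\<^sub>v t = (P * transpose_mat P) *\<^sub>v v"
    unfolding t_def using P Pt v by (simp add: assoc_mult_mat_vec[of _ n n _ n])
  then have Pt_t: "P *\<^sub>v t = v" using v PP by simp
  have "t \<noteq> 0\<^sub>v n"
  proof
    assume "t = 0\<^sub>v n"
    then have "v = 0\<^sub>v n" using Pt_t P by auto
    then show False using v by simp
  qed
  then obtain i where i: "i < n" "t $ i \<noteq> 0"
    using t by (metis carrier_vecD eq_vecI index_zero_vec)
  have "k \<cdot>\<^sub>v t = transpose_mat P *\<^sub>v (diag_conj n P f *\<^sub>v v)"
    unfolding ev t_def using Pt v by (simp add: mult_mat_vec[of _ n n])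
  also have "\<dots> = transpose_mat P *\<^sub>v (P *\<^sub>v (mat_diag n f *\<^sub>v t))"
    unfolding diag_conj_def t_def using P Pt D v
    by (simp add: assoc_mult_mat_vec[of _ n n _ n] del: mat_diag_dim)
  also have "\<dots> = (transpose_mat P * P) *\<^sub>v (mat_diag n f *\<^sub>v t)"
    using P Pt D t by (simp add: assoc_mult_mat_vec[of _ n n _ n] del: mat_diag_dim)
  also have "\<dots> = mat_diag n f *\<^sub>v t" using PP D t by (simp del: mat_diag_dim)
  finally have "k * t $ i = f i * t $ i"
    using mat_diag_mult_vec_index[OF t i(1), of f] t i(1) by (metis index_smult_vec(1) carrier_vecD)
  then show "k \<in> f ` {..<n}" using i by auto
qed

lemma quadratic_form_diag_conj:
  assumes P: "P \<in> carrier_mat n n" and v: "v \<in> carrier_vec n"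
  shows "v \<bullet> (diag_conj n P f *\<^sub>v v) = (\<Sum>i<n. f i * ((transpose_mat P *\<^sub>v v) $ i)\<^sup>2)"
proof -
  let ?t = "transpose_mat P *\<^sub>v v"
  have t: "?t \<in> carrier_vec n" using P v by simp
  note D = mat_diag_dim[of n f]
  have "v \<bullet> (diag_conj n P f *\<^sub>v v) = v \<bullet> (P *\<^sub>v (mat_diag n f *\<^sub>v ?t))"
    unfolding diag_conj_def using P v D by (simp add: assoc_mult_mat_vec[of _ n n _ n])
  also have "\<dots> = ?t \<bullet> (mat_diag n f *\<^sub>v ?t)"
    using transpose_vec_mult_scalar[OF P _ v, of "mat_diag n f *\<^sub>v ?t"] t D by simp
  also have "\<dots> = (\<Sum>i<n. ?t $ i * (mat_diag n f *\<^sub>v ?t) $ i)"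
    using carrier_matD(1)[OF D] by (simp add: scalar_prod_def atLeast0LessThan del: index_mult_mat_vec)
  also have "\<dots> = (\<Sum>i<n. f i * (?t $ i)\<^sup>2)"
    by (intro sum.cong refl) (simp add: mat_diag_mult_vec_index[OF t] power2_eq_square del: index_mult_mat_vec)
  finally show ?thesis .
qed

lemma symmetric_eq_diag_conj:
  fixes M :: "real mat"
  assumes M: "M \<in> carrier_mat n n" and sym: "transpose_mat M = M"
  obtains U d where "U \<in> carrier_mat n n" "transpose_mat U * U = 1\<^sub>m n" "U * transpose_mat U = 1\<^sub>m n"
    "M = diag_conj n U d" "transpose_mat U * M * U = mat_diag n d"
proof -
  obtain U d where U: "U \<in> carrier_mat n n" "transpose_mat U * U = 1\<^sub>m n" "U * transpose_mat U = 1\<^sub>m n"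
    and d: "transpose_mat U * M * U = mat_diag n d"
    using symmetric_real_diagonalization[OF M sym] by blast
  note assoc = assoc_mult_mat[of _ n n _ n _ n]
  have Ut: "transpose_mat U \<in> carrier_mat n n" using U by simp
  have "diag_conj n U d = (U * transpose_mat U) * M * (U * transpose_mat U)"
    unfolding diag_conj_def d[symmetric] using U(1) Ut M by (simp add: assoc)
  also have "\<dots> = M" using U M by simp
  finally show ?thesis using that U d by metis
qed

section \<open>Inverses, square roots and pseudoinverses\<close>

lemma pos_def_imp_pos_semidef: "pos_def X \<Longrightarrow> pos_semidef X"
  unfolding pos_def_def pos_semidef_def sym_mat_def
  by (metis carrier_vecD carrier_vecI dual_order.refl less_imp_le mult_mat_vec_carrier
      scalar_prod_left_zero square_mat.elims(2) carrier_matI)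

lemma pos_def_mat_inv:
  assumes B: "B \<in> carrier_mat n n" and pd: "pos_def B"
  shows "mat_inv B \<in> carrier_mat n n" "B * mat_inv B = 1\<^sub>m n" "mat_inv B * B = 1\<^sub>m n"
    "transpose_mat (mat_inv B) = mat_inv B" "pos_semidef (mat_inv B)"
proof -
  have sym: "transpose_mat B = B" using pd by (simp add: pos_def_def sym_mat_def)
  obtain U d where U: "U \<in> carrier_mat n n" "transpose_mat U * U = 1\<^sub>m n" "U * transpose_mat U = 1\<^sub>m n"
    and Bd: "B = diag_conj n U d" and UBU: "transpose_mat U * B * U = mat_diag n d"
    using symmetric_eq_diag_conj[OF B sym] .
  have d: "d i > 0" if i: "i < n" for i
  proof -
    have c: "col U i \<in> carrier_vec n" using U i by auto
    have "col U i \<noteq> 0\<^sub>v n" using orthogonal_col_nonzero[OF U(1,2) i] .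
    then have "col U i \<bullet> (B *\<^sub>v col U i) > 0" using pd c B by (auto simp: pos_def_def)
    then show ?thesis
      using quadratic_form_col[OF B U(1) i] i by (simp add: UBU mat_diag_def)
  qed
  define G where "G = diag_conj n U (\<lambda>i. 1 / d i)"
  have G: "G \<in> carrier_mat n n" using U by (simp add: G_def)
  \<comment> \<open>The condition is restricted to i < n: beyond the dimension \<open>d\<close> is
    arbitrary and may vanish, in which case d i * (1 / d i) is 0.\<close>
  have one: "diag_conj n U g = 1\<^sub>m n" if "\<And>i. i < n \<Longrightarrow> g i = 1" for g
  proof -
    have "mat_diag n g = 1\<^sub>m n" using that by (auto simp: mat_diag_def intro!: eq_matI)
    then show ?thesis using U by (simp add: diag_conj_def)
  qed
  have BG: "B * G = 1\<^sub>m n" and GB: "G * B = 1\<^sub>m n"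
    unfolding G_def Bd using d by (auto simp: diag_conj_mult[OF U(1,2)] less_imp_neq[symmetric] intro!: one)
  have "mat_inv B = G"
    unfolding mat_inv_def
  proof (rule the_equality)
    show "G \<in> carrier_mat (dim_row B) (dim_row B) \<and> B * G = 1\<^sub>m (dim_row B) \<and> G * B = 1\<^sub>m (dim_row B)"
      using B G BG GB by auto
    fix Y assume "Y \<in> carrier_mat (dim_row B) (dim_row B) \<and> B * Y = 1\<^sub>m (dim_row B) \<and> Y * B = 1\<^sub>m (dim_row B)"
    then have Y: "Y \<in> carrier_mat n n" "Y * B = 1\<^sub>m n" using B by auto
    have "Y = Y * (B * G)" using Y BG by simp
    also have "\<dots> = (Y * B) * G" using assoc_mult_mat[OF Y(1) B G] by simp
    finally show "Y = G" using Y G by simp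
  qed
  moreover have "pos_semidef G"
    unfolding pos_semidef_def sym_mat_def
    using transpose_diag_conj[OF U(1)] U(1) d[THEN less_imp_le]
    by (auto simp: G_def quadratic_form_diag_conj intro!: sum_nonneg)
  ultimately show "mat_inv B \<in> carrier_mat n n" "B * mat_inv B = 1\<^sub>m n" "mat_inv B * B = 1\<^sub>m n"
    "transpose_mat (mat_inv B) = mat_inv B" "pos_semidef (mat_inv B)"
    using G BG GB transpose_diag_conj[OF U(1)] by (simp_all add: G_def)
qed

text \<open>Uniqueness half of the square root, needed to evaluate \<open>psd_sqrt\<close>. It
  suffices that R and Q agree on the orthonormal eigenbasis of Q.\<close>

lemma psd_square_inj:
  assumes R: "R \<in> carrier_mat n n" "pos_semidef R" and Q: "Q \<in> carrier_mat n n" "pos_semidef Q"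
    and eq: "R * R = Q * Q"
  shows "R = Q"
proof -
  have symR: "transpose_mat R = R" and symQ: "transpose_mat Q = Q"
    using R Q by (auto simp: pos_semidef_def sym_mat_def)
  obtain U d where U: "U \<in> carrier_mat n n" "transpose_mat U * U = 1\<^sub>m n" "U * transpose_mat U = 1\<^sub>m n"
    and Qd: "Q = diag_conj n U d" and UQU: "transpose_mat U * Q * U = mat_diag n d"
    using symmetric_eq_diag_conj[OF Q(1) symQ] .
  note assoc = assoc_mult_mat[of _ n n _ n _ n]
  have d0: "d i \<ge> 0" if i: "i < n" for i
  proof -
    have "col U i \<bullet> (Q *\<^sub>v col U i) \<ge> 0" using Q U i by (auto simp: pos_semidef_def)
    then show ?thesis
      using quadratic_form_col[OF Q(1) U(1) i] i by (simp add: UQU mat_diag_def)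
  qed
  have "R *\<^sub>v col U i = d i \<cdot>\<^sub>v col U i" if i: "i < n" for i
  proof -
    define v where "v = col U i"
    have v: "v \<in> carrier_vec n" using U i by (auto simp: v_def)
    have Qv: "Q *\<^sub>v v = d i \<cdot>\<^sub>v v"
      using diag_conj_col[OF U(1,2) i] by (simp add: v_def Qd)
    have Rv: "R *\<^sub>v v \<in> carrier_vec n" using R v by simp
    \<comment> \<open>\<open>w = (R - d\<^sub>i) v\<close> satisfies \<open>R w = - d\<^sub>i w\<close> since \<open>R\<^sup>2 v = d\<^sub>i\<^sup>2 v\<close>; positivity of \<open>R\<close> forces \<open>w = 0\<close>.\<close>
    define w where "w = R *\<^sub>v v - d i \<cdot>\<^sub>v v"
    have w: "w \<in> carrier_vec n" using R v by (simp add: w_def)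
    have RRv: "R *\<^sub>v (R *\<^sub>v v) = (d i * d i) \<cdot>\<^sub>v v"
    proof -
      have "R *\<^sub>v (R *\<^sub>v v) = (Q * Q) *\<^sub>v v" using R v eq by (simp add: assoc_mult_mat_vec[symmetric, of _ n n _ n])
      also have "\<dots> = Q *\<^sub>v (Q *\<^sub>v v)" using Q v by (simp add: assoc_mult_mat_vec[of _ n n _ n])
      also have "\<dots> = (d i * d i) \<cdot>\<^sub>v v" using Q v by (simp add: Qv mult_mat_vec[of _ n n] smult_smult_assoc)
      finally show ?thesis .
    qed
    have Rw: "R *\<^sub>v w = (- d i) \<cdot>\<^sub>v w"
    proof -
      have "R *\<^sub>v w = R *\<^sub>v (R *\<^sub>v v) - d i \<cdot>\<^sub>v (R *\<^sub>v v)"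
        unfolding w_def using R v by (simp add: mult_minus_distrib_mat_vec[of _ n n] mult_mat_vec[of _ n n])
      also have "\<dots> = (- d i) \<cdot>\<^sub>v w"
        unfolding RRv w_def using v R by (intro eq_vecI) (auto simp: algebra_simps)
      finally show ?thesis .
    qed
    have "w \<bullet> w = 0"
    \<comment> \<open>For d i = 0 positivity of R gives no information; there R w = 0 and w = R v,
      so symmetry of R yields w . w = v . R w = 0.\<close>
    proof (cases "d i = 0")
      case True
      then have "w = R *\<^sub>v v" using v R by (auto simp: w_def intro!: eq_vecI)
      then have "w \<bullet> w = v \<bullet> (R *\<^sub>v w)"
        using transpose_vec_mult_scalar[OF R(1) w v] symR by simp
      also have "\<dots> = 0" using True v w by (simp add: Rw)
      finally show ?thesis .
    next
      case False
      have "w \<bullet> (R *\<^sub>v w) \<ge> 0" using R w by (auto simp: pos_semidef_def)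
      then have "d i * (w \<bullet> w) \<le> 0" using w by (simp add: Rw)
      moreover have "d i > 0" using False d0[OF i] by simp
      ultimately show ?thesis using scalar_prod_self_nonneg[of w] by (simp add: mult_le_0_iff)
    qed
    then have "w = 0\<^sub>v n" using scalar_prod_self_eq_0_iff[OF w] by simp
    show ?thesis
    proof (rule eq_vecI)
      fix j assume "j < dim_vec (d i \<cdot>\<^sub>v col U i)"
      then have j: "j < n" using U by simp
      have "w $ j = 0" using \<open>w = 0\<^sub>v n\<close> j by simp
      then show "(R *\<^sub>v col U i) $ j = (d i \<cdot>\<^sub>v col U i) $ j"
        using j U(1) R i unfolding w_def v_def by simp
    qed (use U R in auto)
  qed
  then have col: "col (R * U) i = col (Q * U) i" if "i < n" for i
    using that col_mult2[OF R(1) U(1) that] col_mult2[OF Q(1) U(1) that] diag_conj_col[OF U(1,2) that, of d]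
    by (simp only: Qd)
  have "R * U = Q * U"
    using R Q U(1) by (intro mat_col_eqI col) auto
  then have "(R * U) * transpose_mat U = (Q * U) * transpose_mat U" by simp
  then show "R = Q" using R Q U by (simp add: assoc)
qed

lemma psd_sqrt:
  assumes X: "X \<in> carrier_mat n n" and psd: "pos_semidef X"
  shows "psd_sqrt X \<in> carrier_mat n n" "pos_semidef (psd_sqrt X)" "psd_sqrt X * psd_sqrt X = X"
proof -
  have sym: "transpose_mat X = X" using psd by (simp add: pos_semidef_def sym_mat_def)
  obtain U d where U: "U \<in> carrier_mat n n" "transpose_mat U * U = 1\<^sub>m n" "U * transpose_mat U = 1\<^sub>m n"
    and Xd: "X = diag_conj n U d" and UXU: "transpose_mat U * X * U = mat_diag n d"
    using symmetric_eq_diag_conj[OF X sym] .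
  have d0: "d i \<ge> 0" if i: "i < n" for i
  proof -
    have "col U i \<bullet> (X *\<^sub>v col U i) \<ge> 0" using psd X U i by (auto simp: pos_semidef_def)
    then show ?thesis
      using quadratic_form_col[OF X U(1) i] i by (simp add: UXU mat_diag_def)
  qed
  define R where "R = diag_conj n U (\<lambda>i. sqrt (d i))"
  have R: "R \<in> carrier_mat n n" using U by (simp add: R_def)
  have "pos_semidef R"
    unfolding pos_semidef_def sym_mat_def
    using transpose_diag_conj[OF U(1)] U(1) d0
    by (auto simp: R_def quadratic_form_diag_conj intro!: sum_nonneg)
  moreover have "R * R = X"
  proof -
    have "mat_diag n (\<lambda>i. sqrt (d i) * sqrt (d i)) = mat_diag n d"
      using d0 by (auto simp: mat_diag_def intro!: eq_matI)
    then show ?thesis unfolding R_def Xd diag_conj_mult[OF U(1,2)] by (simp add: diag_conj_def)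
  qed
  moreover have "psd_sqrt X = R"
    unfolding psd_sqrt_def
  proof (rule the_equality)
    fix Q assume "Q \<in> carrier_mat (dim_row X) (dim_row X) \<and> pos_semidef Q \<and> Q * Q = X"
    then show "Q = R" using X R calculation psd_square_inj[of Q n R] by simp
  qed (use X R calculation in simp)
  ultimately show "psd_sqrt X \<in> carrier_mat n n" "pos_semidef (psd_sqrt X)" "psd_sqrt X * psd_sqrt X = X"
    using R by auto
qed

text \<open>\<open>X * Y\<close> and \<open>X * Y'\<close> are both the orthogonal projector onto
  the range of X, and \<open>Y * X\<close> and \<open>Y' * X\<close> both the one onto its row
  space. Once these agree, Y = Y X Y can be rewritten factor by factor into Y' X Y'.\<close>

lemma pinv_unique:
  fixes X :: "real mat"
  assumes X: "X \<in> carrier_mat p q" and Y: "Y \<in> carrier_mat q p" and Y': "Y' \<in> carrier_mat q p"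
    and a: "X * Y * X = X" "Y * X * Y = Y"
      "transpose_mat (X * Y) = X * Y" "transpose_mat (Y * X) = Y * X"
    and b: "X * Y' * X = X" "Y' * X * Y' = Y'"
      "transpose_mat (X * Y') = X * Y'" "transpose_mat (Y' * X) = Y' * X"
  shows "Y = Y'"
proof -
  have c: "X * Y \<in> carrier_mat p p" "X * Y' \<in> carrier_mat p p"
    "Y * X \<in> carrier_mat q q" "Y' * X \<in> carrier_mat q q" using X Y Y' by auto
  have "X * Y = X * Y' * X * Y" by (simp add: b)
  also have "\<dots> = (X * Y') * (X * Y)" by (rule assoc_mult_mat[OF c(2) X Y])
  finally have "transpose_mat (X * Y) = transpose_mat ((X * Y') * (X * Y))" by simp
  then have "X * Y = (X * Y) * (X * Y')"
    using c by (simp add: transpose_mult[of _ p p _ p] a b)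
  also have "\<dots> = (X * Y * X) * Y'" by (rule assoc_mult_mat[OF c(1) X Y', symmetric])
  finally have XY: "X * Y = X * Y'" by (simp add: a)
  have "Y * X = Y * (X * Y' * X)" by (simp add: b)
  also have "\<dots> = (Y * X) * (Y' * X)" using assoc_mult_mat[OF X Y' X] assoc_mult_mat[OF Y X c(4)] by simp
  finally have "transpose_mat (Y * X) = transpose_mat ((Y * X) * (Y' * X))" by simp
  then have "Y * X = (Y' * X) * (Y * X)"
    using c by (simp add: transpose_mult[of _ q q _ q] a b)
  also have "\<dots> = Y' * (X * Y * X)" using assoc_mult_mat[OF X Y X] assoc_mult_mat[OF Y' X c(3)] by simp
  finally have YX: "Y * X = Y' * X" by (simp add: a)
  have "Y = Y' * X * Y" using a YX by simp
  also have "\<dots> = Y' * (X * Y)" by (rule assoc_mult_mat[OF Y' X Y])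
  also have "\<dots> = Y' * X * Y'" unfolding XY by (rule assoc_mult_mat[OF Y' X Y', symmetric])
  finally show ?thesis by (simp add: b)
qed

lemma pinv_symmetric:
  fixes X :: "real mat"
  assumes X: "X \<in> carrier_mat p p" and sym: "transpose_mat X = X"
  shows "pinv X \<in> carrier_mat p p" "pinv X * X * pinv X = pinv X" "transpose_mat (pinv X) = pinv X"
proof -
  obtain U d where U: "U \<in> carrier_mat p p" "transpose_mat U * U = 1\<^sub>m p" "U * transpose_mat U = 1\<^sub>m p"
    and Xd: "X = diag_conj p U d"
    using symmetric_eq_diag_conj[OF X sym] .
  \<comment> \<open>The convention inverse 0 = 0 makes \<open>inverse\<close> the pseudoinverse of a
    scalar, so zero eigenvalues need no case in the definition.\<close>
  define Y where "Y = diag_conj p U (\<lambda>i. inverse (d i))"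
  have Y: "Y \<in> carrier_mat p p" using U by (simp add: Y_def)
  have inv: "(\<lambda>i. d i * inverse (d i) * d i) = d"
    "(\<lambda>i. inverse (d i) * d i * inverse (d i)) = (\<lambda>i. inverse (d i))"
    by (rule ext, case_tac "d i = 0"; simp)+
  have *: "X * Y * X = X" "Y * X * Y = Y" "transpose_mat (X * Y) = X * Y" "transpose_mat (Y * X) = Y * X"
    unfolding Xd Y_def diag_conj_mult[OF U(1,2)] transpose_diag_conj[OF U(1)]
    by (simp_all only: inv)
  have "pinv X = Y"
    unfolding pinv_def
  proof (rule the_equality)
    fix V assume "V \<in> carrier_mat (dim_col X) (dim_row X) \<and> X * V * X = X \<and> V * X * V = V \<and>
      transpose_mat (X * V) = X * V \<and> transpose_mat (V * X) = V * X"
    then have "V \<in> carrier_mat p p" and **: "X * V * X = X" "V * X * V = V"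
      "transpose_mat (X * V) = X * V" "transpose_mat (V * X) = V * X" using X by simp_all
    then show "V = Y" using pinv_unique[OF X _ Y ** *] by simp
  qed (use X Y * in simp)
  then show "pinv X \<in> carrier_mat p p" "pinv X * X * pinv X = pinv X" "transpose_mat (pinv X) = pinv X"
    using Y * transpose_diag_conj[OF U(1)] by (auto simp: Y_def)
qed

section \<open>Scalar heavy ball recursions\<close>

text \<open>The complex roots are never formed. A quadratic form in two consecutive values that is
  scaled by exactly beta in each step replaces their common modulus, and its definiteness replaces
  their being non-real.\<close>

lemma heavy_ball_scalar_bound:
  fixes u :: "nat \<Rightarrow> real"
  assumes rec: "\<And>k. u (Suc (Suc k)) = (1 + \<beta> - \<mu>) * u (Suc k) - \<beta> * u k"
    and \<mu>: "0 < \<mu>" "\<mu> \<le> 1" and \<beta>: "(1 - sqrt \<mu>)\<^sup>2 < \<beta>" "\<beta> < 1"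
  shows "\<exists>C\<ge>0. \<forall>k. (u k)\<^sup>2 \<le> \<beta> ^ k * C"
proof -
  define c where "c = 1 + \<beta> - \<mu>"
  have \<beta>0: "0 < \<beta>" using \<beta>(1) zero_le_power2[of "1 - sqrt \<mu>"] by linarith
  \<comment> \<open>The hypothesis says sqrt mu + sqrt beta > 1, which is symmetric in the two.
    Squaring 1 - sqrt beta < sqrt mu instead gives the discriminant condition c < 2 * sqrt
    beta.\<close>
  have "1 - sqrt \<mu> < sqrt \<beta>" using \<beta>(1) real_less_rsqrt by blast
  then have "(1 - sqrt \<beta>)\<^sup>2 < (sqrt \<mu>)\<^sup>2" using \<beta>(2) by (intro power_strict_mono) auto
  then have "c < 2 * sqrt \<beta>" using \<mu> \<beta>0 by (simp add: c_def power2_diff)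
  \<comment> \<open>The lower bound on c is what permits squaring c < 2 * sqrt beta; it comes from
    mu <= 1.\<close>
  moreover have "0 < c" using \<mu> \<beta>0 by (simp add: c_def)
  ultimately have "c\<^sup>2 < (2 * sqrt \<beta>)\<^sup>2" by (intro power_strict_mono) auto
  then have c: "0 < \<beta> - c\<^sup>2 / 4" using \<beta>0 by (simp add: power_mult_distrib)
  \<comment> \<open>\<open>Q\<close> is multiplied by \<open>\<beta>\<close> in every step, and it is positive definite because the
    characteristic polynomial \<open>x\<^sup>2 - c x + \<beta>\<close> has negative discriminant.\<close>
  define Q where "Q k = (u (Suc k))\<^sup>2 - c * u (Suc k) * u k + \<beta> * (u k)\<^sup>2" for k
  have "Q (Suc k) = \<beta> * Q k" for k
    unfolding Q_def rec c_def by (simp add: algebra_simps power2_eq_square)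
  then have Q: "Q k = \<beta> ^ k * Q 0" for k by (induction k) auto
  have Q_ge: "(\<beta> - c\<^sup>2 / 4) * (u k)\<^sup>2 \<le> Q k" for k
  proof -
    have "Q k = (u (Suc k) - c / 2 * u k)\<^sup>2 + (\<beta> - c\<^sup>2 / 4) * (u k)\<^sup>2"
      unfolding Q_def by (simp add: algebra_simps power2_eq_square)
    then show ?thesis by simp
  qed
  have "(u k)\<^sup>2 \<le> \<beta> ^ k * (Q 0 / (\<beta> - c\<^sup>2 / 4))" for k
    using Q_ge[of k] c by (simp add: Q[of k] pos_le_divide_eq mult.commute)
  moreover have "0 \<le> Q 0 / (\<beta> - c\<^sup>2 / 4)"
  proof -
    have "0 \<le> (\<beta> - c\<^sup>2 / 4) * (u 0)\<^sup>2" using c by simp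
    with Q_ge[of 0] have "0 \<le> Q 0" by linarith
    then show ?thesis using c by (intro divide_nonneg_pos)
  qed
  ultimately show ?thesis by blast
qed

section \<open>Expectations of linear recursions with i.i.d. coefficients\<close>

text \<open>One recursion serves twice: with random coefficients \<open>T\<close> it is the error of
  the iterates, with averaged coefficients it is the mean error. Vectors are plain functions of an
  index so that integrals can be taken entry by entry.\<close>

fun lin_rec :: "nat \<Rightarrow> real \<Rightarrow> (nat \<Rightarrow> nat \<Rightarrow> nat \<Rightarrow> real) \<Rightarrow> (nat \<Rightarrow> real) \<Rightarrow> (nat \<Rightarrow> real) \<Rightarrow> nat \<Rightarrow> nat \<Rightarrow> real"
  where
  "lin_rec n c T u v 0 i = u i"
| "lin_rec n c T u v (Suc 0) i = v i"
| "lin_rec n c T u v (Suc (Suc k)) i =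
     (\<Sum>l<n. T k i l * lin_rec n c T u v (Suc k) l) - c * lin_rec n c T u v k i"

text \<open>Unrolling from the front separates the first coefficient from the shifted sequence, as the
  product structure of the stream space requires.\<close>

lemma lin_rec_Suc_shift:
  "lin_rec n c T u v (Suc k) i =
    lin_rec n c (\<lambda>k. T (Suc k)) v (\<lambda>i. (\<Sum>l<n. T 0 i l * v l) - c * u i) k i"
proof (induction k arbitrary: i rule: induct_nat_012)
  case (ge2 k)
  show ?case
    unfolding lin_rec.simps(3)[of _ _ _ _ _ "Suc k"] ge2.IH[symmetric]
    by (simp only: lin_rec.simps(3)[of _ _ "\<lambda>k. T (Suc k)"] ge2.IH)
qed auto

lemma lin_rec_cong:
  assumes "\<And>k i l. i < n \<Longrightarrow> l < n \<Longrightarrow> T k i l = T' k i l" "i < n"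
  shows "lin_rec n c T u v k i = lin_rec n c T' u v k i"
  using assms(2) by (induction k arbitrary: i rule: induct_nat_012) (simp_all add: assms(1))

text \<open>After the first step is absorbed into the initial data, v is random. Expanding it over
  unit vectors leaves the randomness in the scalar factors \<open>v j\<close>, each multiplying a
  solution with deterministic initial data.\<close>

lemma lin_rec_linear:
  assumes "i < n"
  shows "lin_rec n c T u v k i = lin_rec n c T u (\<lambda>_. 0) k i
    + (\<Sum>j<n. v j * lin_rec n c T (\<lambda>_. 0) (\<lambda>i. if i = j then 1 else 0) k i)"
  using assms
proof (induction k arbitrary: i rule: induct_nat_012)
  case (ge2 k)
  let ?u = "\<lambda>k i. lin_rec n c T u (\<lambda>_. 0) k i"
  let ?e = "\<lambda>k i j. lin_rec n c T (\<lambda>_. 0) (\<lambda>i. if i = j then 1 else 0) k i"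
  have "(\<Sum>l<n. T k i l * lin_rec n c T u v (Suc k) l)
      = (\<Sum>l<n. T k i l * ?u (Suc k) l) + (\<Sum>l<n. \<Sum>j<n. v j * (T k i l * ?e (Suc k) l j))"
    by (simp add: ge2.IH(2) algebra_simps sum.distrib sum_distrib_left)
  also have "(\<Sum>l<n. \<Sum>j<n. v j * (T k i l * ?e (Suc k) l j))
      = (\<Sum>j<n. v j * (\<Sum>l<n. T k i l * ?e (Suc k) l j))"
    by (subst sum.swap) (simp add: sum_distrib_left)
  finally have S: "(\<Sum>l<n. T k i l * lin_rec n c T u v (Suc k) l)
      = (\<Sum>l<n. T k i l * ?u (Suc k) l) + (\<Sum>j<n. v j * (\<Sum>l<n. T k i l * ?e (Suc k) l j))" .
  have "c * lin_rec n c T u v k i = c * ?u k i + (\<Sum>j<n. v j * (c * ?e k i j))"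
    using ge2 by (simp add: algebra_simps sum_distrib_left)
  then show ?case
    by (simp add: S right_diff_distrib sum_subtractf)
qed (auto simp: if_distrib cong: if_cong)

section \<open>Independence of the first sample and the remaining stream\<close>

context prob_space
begin

text \<open>This is the independence of head and tail in usable form: integrals over streams become
  integrals over a product measure.\<close>

lemma distr_stream_cons:
  "distr (M \<Otimes>\<^sub>M stream_space M) (stream_space M) (\<lambda>(a, w). a ## w) = stream_space M"
proof (rule measure_eqI)
  interpret S: prob_space "stream_space M" by (rule prob_space_stream_space)
  fix X assume "X \<in> sets (distr (M \<Otimes>\<^sub>M stream_space M) (stream_space M) (\<lambda>(a, w). a ## w))"
  then have X: "X \<in> sets (stream_space M)" by simp
  have meas: "(\<lambda>(a, w). a ## w) \<in> M \<Otimes>\<^sub>M stream_space M \<rightarrow>\<^sub>M stream_space M" by measurable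
  have "emeasure (distr (M \<Otimes>\<^sub>M stream_space M) (stream_space M) (\<lambda>(a, w). a ## w)) X
      = (\<integral>\<^sup>+a. emeasure (stream_space M) (Pair a -` ((\<lambda>(a, w). a ## w) -` X \<inter> space (M \<Otimes>\<^sub>M stream_space M))) \<partial>M)"
    using X meas by (simp add: emeasure_distr S.emeasure_pair_measure_alt)
  also have "\<dots> = (\<integral>\<^sup>+a. emeasure (stream_space M) {w \<in> space (stream_space M). a ## w \<in> X} \<partial>M)"
    by (intro nn_integral_cong arg_cong2[of _ _ _ _ emeasure] refl) (auto simp: space_pair_measure)
  also have "\<dots> = emeasure (stream_space M) X"
    using emeasure_stream_space[OF X] by simp
  finally show "emeasure (distr (M \<Otimes>\<^sub>M stream_space M) (stream_space M) (\<lambda>(a, w). a ## w)) X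
    = emeasure (stream_space M) X" .
qed simp

lemma
  fixes f :: "'a \<Rightarrow> real" and g :: "'a stream \<Rightarrow> real"
  assumes f: "integrable M f" and g: "integrable (stream_space M) g"
  shows integrable_shd_times_stl: "integrable (stream_space M) (\<lambda>w. f (shd w) * g (stl w))"
    and integral_shd_times_stl:
      "(\<integral>w. f (shd w) * g (stl w) \<partial>stream_space M) = (\<integral>a. f a \<partial>M) * (\<integral>w. g w \<partial>stream_space M)"
proof -
  let ?S = "stream_space M"
  interpret S: prob_space ?S by (rule prob_space_stream_space)
  interpret pair_sigma_finite M ?S ..
  have [measurable]: "f \<in> borel_measurable M" "g \<in> borel_measurable ?S" using f g by auto
  have cons: "(\<lambda>(a, w). a ## w) \<in> M \<Otimes>\<^sub>M ?S \<rightarrow>\<^sub>M ?S" by measurable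
  have meas: "(\<lambda>w. f (shd w) * g (stl w)) \<in> borel_measurable ?S" by measurable
  have int: "integrable (M \<Otimes>\<^sub>M ?S) (\<lambda>x. f (fst x) * g (snd x))"
  proof (rule Fubini_integrable)
    have "integrable M (\<lambda>a. \<bar>f a\<bar> * (\<integral>w. \<bar>g w\<bar> \<partial>?S))" using f by simp
    then show "integrable M (\<lambda>a. \<integral>w. norm (f (fst (a, w)) * g (snd (a, w))) \<partial>?S)"
      by (simp add: abs_mult)
  qed (use g in \<open>auto intro!: AE_I2\<close>)
  then show "integrable ?S (\<lambda>w. f (shd w) * g (stl w))"
    by (subst distr_stream_cons[symmetric], subst integrable_distr_eq[OF cons meas])
      (simp add: case_prod_beta)
  have "(\<integral>w. f (shd w) * g (stl w) \<partial>?S) = (\<integral>x. f (fst x) * g (snd x) \<partial>(M \<Otimes>\<^sub>M ?S))"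
    by (subst distr_stream_cons[symmetric], subst integral_distr[OF cons meas])
      (simp add: case_prod_beta)
  also have "\<dots> = (\<integral>a. f a \<partial>M) * (\<integral>w. g w \<partial>?S)"
    using integral_fst'[OF int] by simp
  finally show "(\<integral>w. f (shd w) * g (stl w) \<partial>?S) = (\<integral>a. f a \<partial>M) * (\<integral>w. g w \<partial>?S)" .
qed

lemma
  fixes g :: "'a stream \<Rightarrow> real"
  assumes g: "integrable (stream_space M) g"
  shows integrable_stl: "integrable (stream_space M) (\<lambda>w. g (stl w))"
    and integral_stl: "(\<integral>w. g (stl w) \<partial>stream_space M) = (\<integral>w. g w \<partial>stream_space M)"
  using integrable_shd_times_stl[of "\<lambda>_. 1", OF _ g] integral_shd_times_stl[of "\<lambda>_. 1", OF _ g]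
  by (simp_all add: prob_space)

text \<open>Induction on k with the initial data generalized. The shift moves the first random
  matrix into the second initial vector, linearity splits it off as a scalar, and every term is then
  a function of the head times a function of the tail, whose expectation factors. Integrability is
  carried along because the product rule requires it.\<close>

lemma expectation_lin_rec:
  fixes T :: "'a \<Rightarrow> nat \<Rightarrow> nat \<Rightarrow> real"
  assumes T: "\<And>i j. i < n \<Longrightarrow> j < n \<Longrightarrow> integrable M (\<lambda>a. T a i j)" and i: "i < n"
  shows "integrable (stream_space M) (\<lambda>w. lin_rec n c (\<lambda>k. T (w !! k)) u v k i) \<and>
    (\<integral>w. lin_rec n c (\<lambda>k. T (w !! k)) u v k i \<partial>stream_space M)
      = lin_rec n c (\<lambda>_ i j. \<integral>a. T a i j \<partial>M) u v k i"
  using i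
proof (induction k arbitrary: u v i)
  case 0
  interpret S: prob_space "stream_space M" by (rule prob_space_stream_space)
  show ?case by (simp add: S.prob_space)
next
  case (Suc k)
  let ?S = "stream_space M"
  let ?L = "\<lambda>u v w. lin_rec n c (\<lambda>k. T (w !! k)) u v k i"
  let ?M = "\<lambda>u v. lin_rec n c (\<lambda>_ i j. \<integral>a. T a i j \<partial>M) u v k i"
  let ?e = "\<lambda>j i. if i = j then 1 else (0 :: real)"
  let ?v = "\<lambda>a j. (\<Sum>l<n. T a j l * v l) - c * u j"
  \<comment> \<open>The tail factors start from (v, 0) and from (0, unit vector), both
    deterministic, so the induction hypothesis applies to them.\<close>
  have eq: "lin_rec n c (\<lambda>k. T (w !! k)) u v (Suc k) i
      = ?L v (\<lambda>_. 0) (stl w) + (\<Sum>j<n. ?v (shd w) j * ?L (\<lambda>_. 0) (?e j) (stl w))" for w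
    unfolding lin_rec_Suc_shift by (subst lin_rec_linear[OF Suc.prems]) simp
  have v: "integrable M (\<lambda>a. ?v a j)" if "j < n" for j
    using that T by (intro Bochner_Integration.integrable_diff Bochner_Integration.integrable_sum) auto
  have Ev: "(\<integral>a. ?v a j \<partial>M) = (\<Sum>l<n. (\<integral>a. T a j l \<partial>M) * v l) - c * u j" if "j < n" for j
    using that T by (subst Bochner_Integration.integral_diff)
      (auto simp: prob_space Bochner_Integration.integral_sum intro!: Bochner_Integration.integrable_sum)
  note IH = Suc.IH[OF Suc.prems]
  have int: "integrable ?S (\<lambda>w. ?v (shd w) j * ?L (\<lambda>_. 0) (?e j) (stl w))" if "j < n" for j
    using integrable_shd_times_stl[OF v[OF that], of "?L (\<lambda>_. 0) (?e j)"] IH by simp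
  have int0: "integrable ?S (\<lambda>w. ?L v (\<lambda>_. 0) (stl w))"
    using integrable_stl[of "?L v (\<lambda>_. 0)"] IH by simp
  have "(\<integral>w. lin_rec n c (\<lambda>k. T (w !! k)) u v (Suc k) i \<partial>?S)
      = (\<integral>w. ?L v (\<lambda>_. 0) (stl w) \<partial>?S)
        + (\<Sum>j<n. (\<integral>w. ?v (shd w) j * ?L (\<lambda>_. 0) (?e j) (stl w) \<partial>?S))"
    unfolding eq using int int0
    by (subst Bochner_Integration.integral_add)
      (auto simp: Bochner_Integration.integral_sum intro!: Bochner_Integration.integrable_sum)
  also have "(\<integral>w. ?L v (\<lambda>_. 0) (stl w) \<partial>?S) = ?M v (\<lambda>_. 0)"
    using integral_stl[of "?L v (\<lambda>_. 0)"] IH by simp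
  also have "(\<Sum>j<n. (\<integral>w. ?v (shd w) j * ?L (\<lambda>_. 0) (?e j) (stl w) \<partial>?S))
      = (\<Sum>j<n. ((\<Sum>l<n. (\<integral>a. T a j l \<partial>M) * v l) - c * u j) * ?M (\<lambda>_. 0) (?e j))"
  proof (intro sum.cong refl)
    fix j assume "j \<in> {..<n}"
    then have j: "j < n" by simp
    show "(\<integral>w. ?v (shd w) j * ?L (\<lambda>_. 0) (?e j) (stl w) \<partial>?S)
      = ((\<Sum>l<n. (\<integral>a. T a j l \<partial>M) * v l) - c * u j) * ?M (\<lambda>_. 0) (?e j)"
      using integral_shd_times_stl[OF v[OF j], of "?L (\<lambda>_. 0) (?e j)"] IH Ev[OF j] by simp
  qed
  finally have "(\<integral>w. lin_rec n c (\<lambda>k. T (w !! k)) u v (Suc k) i \<partial>?S)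
      = lin_rec n c (\<lambda>_ i j. \<integral>a. T a i j \<partial>M) u v (Suc k) i"
    \<comment> \<open>The same expansion is read backwards for the averaged coefficients.\<close>
    unfolding lin_rec_Suc_shift[of n c "\<lambda>_ i j. \<integral>a. T a i j \<partial>M"]
    by (subst lin_rec_linear[OF Suc.prems])
  moreover have "integrable ?S (\<lambda>w. lin_rec n c (\<lambda>k. T (w !! k)) u v (Suc k) i)"
    unfolding eq using int int0
    by (intro Bochner_Integration.integrable_add Bochner_Integration.integrable_sum) auto
  ultimately show ?case by blast
qed

end

section \<open>The sketched system\<close>

lemma quadratic_form_eq_sum:
  fixes M :: "real mat"
  assumes "M \<in> carrier_mat n n" "v \<in> carrier_vec n"
  shows "v \<bullet> (M *\<^sub>v v) = (\<Sum>i<n. \<Sum>j<n. v $ i * M $$ (i,j) * v $ j)"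
  using assms by (simp add: scalar_prod_def atLeast0LessThan sum_distrib_left mult.assoc)

locale sketched_system =
  fixes A B :: "real mat" and m n :: nat and D :: "'a measure" and sk :: "'a \<Rightarrow> real mat"
  assumes A: "A \<in> carrier_mat m n" and B: "B \<in> carrier_mat n n" and Bpd: "pos_def B"
    and D: "prob_space D" and skdim: "\<And>a. dim_row (sk a) = m"
    and Zint: "\<And>i j. i < n \<Longrightarrow> j < n \<Longrightarrow> integrable D (\<lambda>a. Z_mat A B (sk a) $$ (i,j))"
    and exact: "mat_kernel (EZ A B D sk) = mat_kernel A"
begin

abbreviation "G \<equiv> mat_inv B"
abbreviation "Z a \<equiv> Z_mat A B (sk a)"
abbreviation "E \<equiv> EZ A B D sk"
abbreviation "W \<equiv> W_mat A B D sk"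

lemmas G = pos_def_mat_inv[OF B Bpd]

lemma Bsym: "transpose_mat B = B"
  using Bpd by (simp add: pos_def_def sym_mat_def)

text \<open>With C = A^T S the sketched matrix is Z = C Y C^T, where Y is the pseudoinverse of M =
  C^T G C. The Penrose identity Y M Y = Y then gives Z G Z = Z, which says that G Z is a
  projection.\<close>

lemma Z_carrier: "Z a \<in> carrier_mat n n"
  and Z_sym: "transpose_mat (Z a) = Z a"
  and Z_G_Z: "Z a * G * Z a = Z a"
  and Z_mult_vec: "x \<in> carrier_vec n \<Longrightarrow>
    Z a *\<^sub>v x = transpose_mat A *\<^sub>v (H_mat A B (sk a) *\<^sub>v (A *\<^sub>v x))"
proof -
  define q where "q = dim_col (sk a)"
  define S where "S = sk a"
  have S: "S \<in> carrier_mat m q" using skdim by (auto simp: q_def S_def)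
  have St: "transpose_mat S \<in> carrier_mat q m" using S by simp
  have At: "transpose_mat A \<in> carrier_mat n m" using A by simp
  define C where "C = transpose_mat A * S"
  have C: "C \<in> carrier_mat n q" using At S by (simp add: C_def)
  have Ct: "transpose_mat C \<in> carrier_mat q n" using C by simp
  have Ct_eq: "transpose_mat C = transpose_mat S * A"
    unfolding C_def using At S by (simp add: transpose_mult[of _ n m _ q])
  define M where "M = transpose_mat C * G * C"
  have M: "M \<in> carrier_mat q q" using Ct G C by (simp add: M_def)
  have GC: "G * C \<in> carrier_mat n q" using G C by simp
  have CtG: "transpose_mat C * G \<in> carrier_mat q n" using G Ct by simp
  \<comment> \<open>\<open>pinv\<close> has been evaluated for symmetric arguments only, and
    symmetry of Y is also what makes Z symmetric.\<close>
  have "transpose_mat (transpose_mat C * G * C) = transpose_mat C * (G * C)"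
    using G(4) transpose_mult[OF CtG C] transpose_mult[OF Ct G(1)] by simp
  also have "\<dots> = transpose_mat C * G * C" using assoc_mult_mat[OF Ct G(1) C] by simp
  finally have Msym: "transpose_mat M = M" by (simp add: M_def)
  define Y where "Y = pinv M"
  note Y = pinv_symmetric[OF M Msym, folded Y_def]
  have M_eq: "transpose_mat S * A * G * transpose_mat A * S = M"
  proof -
    have c: "transpose_mat S * A * G \<in> carrier_mat q n" using St A G by simp
    show ?thesis unfolding M_def Ct_eq using assoc_mult_mat[OF c At S] by (simp add: C_def)
  qed
  have SY: "S * Y \<in> carrier_mat m q" using S Y by simp
  have H: "H_mat A B S = S * Y * transpose_mat S"
    unfolding H_mat_def M_eq by (simp add: Y_def)
  have Hc: "H_mat A B S \<in> carrier_mat m m" unfolding H using SY St by simp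
  have CY: "C * Y \<in> carrier_mat n q" using C Y by simp
  have Z: "Z a = C * Y * transpose_mat C"
  proof -
    have "Z a = transpose_mat A * (S * Y * transpose_mat S) * A"
      unfolding Z_mat_def S_def[symmetric] H ..
    also have "\<dots> = transpose_mat A * (S * Y) * transpose_mat S * A"
      using assoc_mult_mat[OF At SY St] by simp
    also have "transpose_mat A * (S * Y) = C * Y"
      unfolding C_def using assoc_mult_mat[OF At S Y(1)] by simp
    also have "C * Y * transpose_mat S * A = C * Y * transpose_mat C"
      unfolding Ct_eq using assoc_mult_mat[OF CY St A] by simp
    finally show ?thesis .
  qed
  show Zc: "Z a \<in> carrier_mat n n" unfolding Z using CY Ct by simp
  show "transpose_mat (Z a) = Z a"
    unfolding Z using transpose_mult[OF CY Ct] transpose_mult[OF C Y(1)] assoc_mult_mat[OF C Y(1) Ct] Y(3)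
    by simp
  have YCt: "Y * transpose_mat C \<in> carrier_mat q n" using Y Ct by simp
  have "Z a * G * Z a = C * Y * transpose_mat C * G * (C * Y * transpose_mat C)"
    unfolding Z ..
  also have "\<dots> = C * Y * (transpose_mat C * G) * (C * (Y * transpose_mat C))"
    using assoc_mult_mat[OF CY Ct G(1)] assoc_mult_mat[OF C Y(1) Ct] by simp
  also have "\<dots> = C * Y * ((transpose_mat C * G) * (C * (Y * transpose_mat C)))"
    by (rule assoc_mult_mat[OF CY CtG mult_carrier_mat[OF C YCt]])
  also have "(transpose_mat C * G) * (C * (Y * transpose_mat C)) = M * (Y * transpose_mat C)"
    unfolding M_def using assoc_mult_mat[OF CtG C YCt] by simp
  also have "C * Y * (M * (Y * transpose_mat C)) = C * (Y * M * Y * transpose_mat C)"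
  proof -
    have MY: "M * Y \<in> carrier_mat q q" using M Y by simp
    have YM: "Y * M \<in> carrier_mat q q" using M Y by simp
    have YMYCt: "M * (Y * transpose_mat C) \<in> carrier_mat q n" using M YCt by simp
    have "C * Y * (M * (Y * transpose_mat C)) = C * (Y * (M * (Y * transpose_mat C)))"
      by (rule assoc_mult_mat[OF C Y(1) YMYCt])
    also have "Y * (M * (Y * transpose_mat C)) = Y * M * (Y * transpose_mat C)"
      using assoc_mult_mat[OF Y(1) M YCt] by simp
    also have "\<dots> = Y * M * Y * transpose_mat C"
      using assoc_mult_mat[OF YM Y(1) Ct] by simp
    finally show ?thesis .
  qed
  also have "\<dots> = C * (Y * transpose_mat C)" unfolding Y(2) ..
  also have "\<dots> = Z a" unfolding Z using assoc_mult_mat[OF C Y(1) Ct] by simp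
  finally show "Z a * G * Z a = Z a" .
  assume x: "x \<in> carrier_vec n"
  have AtH: "transpose_mat A * H_mat A B S \<in> carrier_mat n m" using At Hc by simp
  show "Z a *\<^sub>v x = transpose_mat A *\<^sub>v (H_mat A B (sk a) *\<^sub>v (A *\<^sub>v x))"
    unfolding Z_mat_def S_def[symmetric]
    using assoc_mult_mat_vec[OF AtH A x] assoc_mult_mat_vec[OF At Hc, of "A *\<^sub>v x"] A x by simp
qed

text \<open>g = G Z v is the B-orthogonal projection of v onto the range of G Z. Thus v . Z v is the
  squared B-norm of g, and v . B v - v . Z v that of v - g.\<close>

lemma Z_bounds:
  assumes v: "v \<in> carrier_vec n"
  shows "0 \<le> v \<bullet> (Z a *\<^sub>v v)" "v \<bullet> (Z a *\<^sub>v v) \<le> v \<bullet> (B *\<^sub>v v)"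
proof -
  define z where "z = Z a *\<^sub>v v"
  define g where "g = G *\<^sub>v z"
  have z: "z \<in> carrier_vec n" unfolding z_def by (rule mult_mat_vec_carrier[OF Z_carrier v])
  have g: "g \<in> carrier_vec n" using G z by (simp add: g_def)
  have "Z a *\<^sub>v g = Z a * G * Z a *\<^sub>v v"
    unfolding g_def z_def using Z_carrier[of a] G(1) v
    by (simp add: assoc_mult_mat_vec[of _ n n _ n])
  then have Zg: "Z a *\<^sub>v g = z" by (simp add: Z_G_Z z_def)
  have vz: "v \<bullet> z = z \<bullet> g"
    using transpose_vec_mult_scalar[OF Z_carrier[of a] g v] by (simp add: Z_sym Zg z_def)
  have "z \<bullet> g \<ge> 0" using G z by (simp add: pos_semidef_def g_def)
  then show "0 \<le> v \<bullet> (Z a *\<^sub>v v)" using vz by (simp add: z_def)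
  have Bg: "B *\<^sub>v g = z"
    unfolding g_def using B G(1,2) z by (simp flip: assoc_mult_mat_vec[of _ n n _ n])
  have gBv: "g \<bullet> (B *\<^sub>v v) = z \<bullet> v"
    using transpose_vec_mult_scalar[OF B v g] by (simp add: Bsym Bg)
  \<comment> \<open>With \<open>g = G Z v\<close>, this expands to \<open>v \<bullet> B v - v \<bullet> Z v\<close>.\<close>
  have "0 \<le> (v - g) \<bullet> (B *\<^sub>v (v - g))"
    using pos_def_imp_pos_semidef[OF Bpd] B v g by (simp add: pos_semidef_def)
  also have "\<dots> = v \<bullet> (B *\<^sub>v v) - v \<bullet> z - (g \<bullet> (B *\<^sub>v v) - g \<bullet> z)"
    using B v g z
    by (simp add: mult_minus_distrib_mat_vec[of _ n n] Bg minus_scalar_prod_distrib[of _ n]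
        scalar_prod_minus_distrib[of _ n])
  also have "\<dots> = v \<bullet> (B *\<^sub>v v) - v \<bullet> z"
    using gBv vz comm_scalar_prod[OF g z] comm_scalar_prod[OF v z] by simp
  finally show "v \<bullet> (Z a *\<^sub>v v) \<le> v \<bullet> (B *\<^sub>v v)" by (simp add: z_def)
qed

lemma E_carrier: "E \<in> carrier_mat n n"
  using A by (simp add: EZ_def)

lemma E_index: "i < n \<Longrightarrow> j < n \<Longrightarrow> E $$ (i,j) = (\<integral>a. Z a $$ (i,j) \<partial>D)"
  using A by (simp add: EZ_def)

lemma E_sym: "transpose_mat E = E"
proof (rule eq_matI)
  fix i j assume "i < dim_row E" "j < dim_col E"
  then have ij: "i < n" "j < n" using E_carrier by auto
  have "Z a $$ (j,i) = Z a $$ (i,j)" for a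
    using arg_cong[OF Z_sym[of a], of "\<lambda>M. M $$ (i,j)"] Z_carrier[of a] ij by simp
  then show "transpose_mat E $$ (i,j) = E $$ (i,j)" using ij E_carrier by (simp add: E_index)
qed (use E_carrier in auto)

text \<open>The quadratic form is a finite linear combination of the entries of Z, so it is
  integrable and commutes with the expectation; the upper bound survives because D has total mass
  1.\<close>

lemma E_bounds:
  assumes v: "v \<in> carrier_vec n"
  shows "0 \<le> v \<bullet> (E *\<^sub>v v)" "v \<bullet> (E *\<^sub>v v) \<le> v \<bullet> (B *\<^sub>v v)"
proof -
  interpret prob_space D by (rule D)
  have form: "v \<bullet> (Z a *\<^sub>v v) = (\<Sum>i<n. \<Sum>j<n. v $ i * Z a $$ (i,j) * v $ j)" for a
    by (rule quadratic_form_eq_sum[OF Z_carrier v])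
  have int: "integrable D (\<lambda>a. v \<bullet> (Z a *\<^sub>v v))"
    unfolding form
    by (auto intro!: Bochner_Integration.integrable_sum integrable_mult_left integrable_mult_right Zint)
  have "v \<bullet> (E *\<^sub>v v) = (\<Sum>i<n. \<Sum>j<n. v $ i * (\<integral>a. Z a $$ (i,j) \<partial>D) * v $ j)"
    by (simp add: quadratic_form_eq_sum[OF E_carrier v] E_index)
  also have "\<dots> = (\<Sum>i<n. (\<integral>a. (\<Sum>j<n. v $ i * Z a $$ (i,j) * v $ j) \<partial>D))"
    using Zint by (intro sum.cong refl) (subst Bochner_Integration.integral_sum, auto)
  also have "\<dots> = (\<integral>a. v \<bullet> (Z a *\<^sub>v v) \<partial>D)"
    unfolding form
    by (rule Bochner_Integration.integral_sum [symmetric])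
      (auto intro!: Bochner_Integration.integrable_sum integrable_mult_left integrable_mult_right Zint)
  finally have eq: "v \<bullet> (E *\<^sub>v v) = (\<integral>a. v \<bullet> (Z a *\<^sub>v v) \<partial>D)" .
  show "0 \<le> v \<bullet> (E *\<^sub>v v)" unfolding eq using Z_bounds[OF v] by simp
  have "(\<integral>a. v \<bullet> (Z a *\<^sub>v v) \<partial>D) \<le> (\<integral>a. v \<bullet> (B *\<^sub>v v) \<partial>D)"
    using Z_bounds[OF v] int by (intro integral_mono) auto
  then show "v \<bullet> (E *\<^sub>v v) \<le> v \<bullet> (B *\<^sub>v v)" unfolding eq by (simp add: prob_space)
qed

lemma simultaneous_diagonalization:
  obtains P d where "P \<in> carrier_mat n n" "transpose_mat P * B * P = 1\<^sub>m n"
    "P * transpose_mat P = G" "transpose_mat P * E * P = mat_diag n d"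
    "{k. eigenvalue W k} = d ` {..<n}" "\<And>i. i < n \<Longrightarrow> 0 \<le> d i" "\<And>i. i < n \<Longrightarrow> d i \<le> 1"
proof -
  note assoc = assoc_mult_mat[of _ n n _ n _ n]
  define R where "R = psd_sqrt G"
  have R: "R \<in> carrier_mat n n" "transpose_mat R = R" "R * R = G"
    using psd_sqrt[OF G(1,5)] by (auto simp: R_def pos_semidef_def sym_mat_def)
  have RB: "R * B \<in> carrier_mat n n" using R B by simp
  have "R * (R * B) = 1\<^sub>m n" using R G(3) B by (simp flip: assoc)
  \<comment> \<open>R * (R * B) = G * B = 1, so R * B is a right inverse of the square matrix R and
    hence also a left inverse.\<close>
  then have RBR: "R * B * R = 1\<^sub>m n" using mat_mult_left_right_inverse[OF R(1) RB] by simp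
  have W: "W = R * E * R" by (simp add: W_mat_def R_def)
  have Wc: "W \<in> carrier_mat n n" using R E_carrier by (simp add: W)
  have "transpose_mat W = W"
    unfolding W using R E_carrier by (simp add: transpose_mult[of _ n n _ n] E_sym assoc)
  then obtain U d where U: "U \<in> carrier_mat n n" "transpose_mat U * U = 1\<^sub>m n" "U * transpose_mat U = 1\<^sub>m n"
    and Wd: "W = diag_conj n U d" and UWU: "transpose_mat U * W * U = mat_diag n d"
    using symmetric_eq_diag_conj[OF Wc] by metis
  have Ut: "transpose_mat U \<in> carrier_mat n n" using U by simp
  define P where "P = R * U"
  have P: "P \<in> carrier_mat n n" using R U by (simp add: P_def)
  have Pt: "transpose_mat P = transpose_mat U * R"
    using R U by (simp add: P_def transpose_mult[of _ n n _ n])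
  have "transpose_mat P * B * P = transpose_mat U * (R * B * R) * U"
    unfolding Pt unfolding P_def using R U Ut B by (simp add: assoc)
  then have PBP: "transpose_mat P * B * P = 1\<^sub>m n" using U Ut by (simp add: RBR)
  have "P * transpose_mat P = R * (U * transpose_mat U) * R"
    unfolding Pt unfolding P_def using R(1) U(1) Ut by (simp add: assoc)
  then have PP: "P * transpose_mat P = G" using R U by simp
  have "transpose_mat P * E * P = transpose_mat U * (R * E * R) * U"
    unfolding Pt unfolding P_def using R U Ut E_carrier by (simp add: assoc)
  then have PEP: "transpose_mat P * E * P = mat_diag n d" using UWU by (simp add: W)
  \<comment> \<open>Column i of P has B-norm 1 and d i is the value of the form E on it, so the
    bounds on E apply directly.\<close>
  have "0 \<le> d i \<and> d i \<le> 1" if i: "i < n" for i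
  proof -
    have c: "col P i \<in> carrier_vec n" using P i by auto
    have "col P i \<bullet> (E *\<^sub>v col P i) = d i"
      using quadratic_form_col[OF E_carrier P i] i by (simp add: PEP mat_diag_def)
    moreover have "col P i \<bullet> (B *\<^sub>v col P i) = 1"
      using quadratic_form_col[OF B P i] i by (simp add: PBP)
    ultimately show ?thesis using E_bounds[OF c] by simp
  qed
  then show ?thesis
    using that[OF P PBP PP PEP] eigenvalues_diag_conj[OF U, of d] by (simp add: Wd)
qed

end

section \<open>Eigencoordinates and the projection\<close>

locale diagonalized_system = sketched_system A B m n D sk
  for A B :: "real mat" and m n :: nat and D :: "'a measure" and sk :: "'a \<Rightarrow> real mat" +
  fixes P :: "real mat" and d :: "nat \<Rightarrow> real"
  assumes P: "P \<in> carrier_mat n n" and PBP: "transpose_mat P * B * P = 1\<^sub>m n"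
    and PP: "P * transpose_mat P = G" and PEP: "transpose_mat P * E * P = mat_diag n d"
    and eigenvalues_W: "{k. eigenvalue W k} = d ` {..<n}"
    and d_nonneg: "\<And>i. i < n \<Longrightarrow> 0 \<le> d i" and d_le_1: "\<And>i. i < n \<Longrightarrow> d i \<le> 1"
begin

text \<open>Since P^T B P = 1, the matrix P^T B is the inverse of P: these are the coordinates with
  respect to the B-orthonormal columns of P.\<close>

definition coord :: "real vec \<Rightarrow> real vec" where
  "coord v = transpose_mat P *\<^sub>v (B *\<^sub>v v)"

lemma Pt: "transpose_mat P \<in> carrier_mat n n"
  using P by simp

lemma coord_carrier [simp]: "v \<in> carrier_vec n \<Longrightarrow> coord v \<in> carrier_vec n"
  using Pt B by (simp add: coord_def)

lemma coord_dim [simp]: "dim_vec (coord v) = n"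
  using P by (simp add: coord_def)

lemma coord_diff: "v \<in> carrier_vec n \<Longrightarrow> w \<in> carrier_vec n \<Longrightarrow> coord (v - w) = coord v - coord w"
  using Pt B by (simp add: coord_def mult_minus_distrib_mat_vec[of _ n n])

lemma coord_add: "v \<in> carrier_vec n \<Longrightarrow> w \<in> carrier_vec n \<Longrightarrow> coord (v + w) = coord v + coord w"
  using Pt B by (simp add: coord_def mult_add_distrib_mat_vec[of _ n n])

lemma coord_smult: "v \<in> carrier_vec n \<Longrightarrow> coord (c \<cdot>\<^sub>v v) = c \<cdot>\<^sub>v coord v"
  using Pt B by (simp add: coord_def mult_mat_vec[of _ n n])

lemma P_coord: "v \<in> carrier_vec n \<Longrightarrow> P *\<^sub>v coord v = v"
proof -
  assume v: "v \<in> carrier_vec n"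
  have "P *\<^sub>v coord v = (P * transpose_mat P) *\<^sub>v (B *\<^sub>v v)"
    unfolding coord_def using P Pt B v by (simp add: assoc_mult_mat_vec[of _ n n _ n])
  also have "\<dots> = (G * B) *\<^sub>v v"
    unfolding PP using B G(1) v by (simp add: assoc_mult_mat_vec[of _ n n _ n])
  also have "\<dots> = v" using G(3) v by simp
  finally show ?thesis .
qed

lemma coord_P: "s \<in> carrier_vec n \<Longrightarrow> coord (P *\<^sub>v s) = s"
proof -
  assume s: "s \<in> carrier_vec n"
  have "coord (P *\<^sub>v s) = (transpose_mat P * B * P) *\<^sub>v s"
    unfolding coord_def using P Pt B s by (simp add: assoc_mult_mat_vec[of _ n n _ n])
  then show ?thesis using s by (simp add: PBP)
qed

lemma coord_eq_0: "v \<in> carrier_vec n \<Longrightarrow> coord v = 0\<^sub>v n \<Longrightarrow> v = 0\<^sub>v n"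
  using P_coord[of v] P by auto

lemma coord_G: "v \<in> carrier_vec n \<Longrightarrow> coord (G *\<^sub>v v) = transpose_mat P *\<^sub>v v"
  unfolding coord_def using B G(1,2) Pt by (simp flip: assoc_mult_mat_vec[of _ n n _ n])

lemma Pt_E: "v \<in> carrier_vec n \<Longrightarrow> transpose_mat P *\<^sub>v (E *\<^sub>v v) = mat_diag n d *\<^sub>v coord v"
proof -
  assume v: "v \<in> carrier_vec n"
  have "mat_diag n d *\<^sub>v coord v = transpose_mat P *\<^sub>v (E *\<^sub>v (P *\<^sub>v coord v))"
    unfolding PEP[symmetric] using P Pt E_carrier v by (simp add: assoc_mult_mat_vec[of _ n n _ n])
  then show ?thesis using v by (simp add: P_coord)
qed

lemma B_norm_eq: "v \<in> carrier_vec n \<Longrightarrow> (B_norm B v)\<^sup>2 = (\<Sum>i<n. (coord v $ i)\<^sup>2)"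
  and B_norm_eq_sqrt: "v \<in> carrier_vec n \<Longrightarrow> B_norm B v = sqrt (\<Sum>i<n. (coord v $ i)\<^sup>2)"
proof -
  assume v: "v \<in> carrier_vec n"
  have c: "coord v \<in> carrier_vec n" using v by simp
  have Bv: "B *\<^sub>v v \<in> carrier_vec n" using B v by simp
  have "B_inner B v v = (P *\<^sub>v coord v) \<bullet> (B *\<^sub>v v)"
    by (simp add: B_inner_def P_coord v)
  also have "\<dots> = coord v \<bullet> coord v"
    using transpose_vec_mult_scalar[OF Pt Bv c] P by (simp add: coord_def)
  also have "\<dots> = (\<Sum>i<n. (coord v $ i)\<^sup>2)" by (rule scalar_prod_self_eq_sum[OF c])
  finally have *: "B_inner B v v = (\<Sum>i<n. (coord v $ i)\<^sup>2)" .
  then show "B_norm B v = sqrt (\<Sum>i<n. (coord v $ i)\<^sup>2)" by (simp add: B_norm_def)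
  then show "(B_norm B v)\<^sup>2 = (\<Sum>i<n. (coord v $ i)\<^sup>2)" by (simp add: sum_nonneg)
qed

text \<open>Exactness enters here: the null space of A is that of E, and in these coordinates E
  acts, up to the invertible factor G, as \<open>mat_diag n d\<close>.\<close>

lemma A_mult_eq_0_iff:
  assumes v: "v \<in> carrier_vec n"
  shows "A *\<^sub>v v = 0\<^sub>v m \<longleftrightarrow> (\<forall>i<n. d i \<noteq> 0 \<longrightarrow> coord v $ i = 0)"
proof -
  define e where "e = E *\<^sub>v v"
  have e: "e \<in> carrier_vec n" using E_carrier v by (simp add: e_def)
  have Ge: "G *\<^sub>v e \<in> carrier_vec n" using G(1) e by simp
  have "A *\<^sub>v v = 0\<^sub>v m \<longleftrightarrow> v \<in> mat_kernel A" using v by (auto simp: mat_kernel[OF A])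
  also have "\<dots> \<longleftrightarrow> e = 0\<^sub>v n" using v by (auto simp: exact[symmetric] mat_kernel[OF E_carrier] e_def)
  also have "\<dots> \<longleftrightarrow> coord (G *\<^sub>v e) = 0\<^sub>v n"
  proof
    assume "e = 0\<^sub>v n"
    then show "coord (G *\<^sub>v e) = 0\<^sub>v n" using P e by (auto simp: coord_G intro!: eq_vecI)
  next
    assume "coord (G *\<^sub>v e) = 0\<^sub>v n"
    then have "G *\<^sub>v e = 0\<^sub>v n" by (rule coord_eq_0[OF Ge])
    then have "B *\<^sub>v (G *\<^sub>v e) = 0\<^sub>v n" using B by (auto intro!: eq_vecI)
    then show "e = 0\<^sub>v n" using assoc_mult_mat_vec[OF B G(1) e] G(2) e by simp
  qed
  also have "\<dots> \<longleftrightarrow> mat_diag n d *\<^sub>v coord v = 0\<^sub>v n" using e v by (simp add: coord_G) (simp add: e_def Pt_E)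
  also have "\<dots> \<longleftrightarrow> (\<forall>i<n. (mat_diag n d *\<^sub>v coord v) $ i = 0)"
    using carrier_matD(1)[OF mat_diag_dim[of n d]] by (auto intro!: eq_vecI simp del: index_mult_mat_vec)
  also have "\<dots> \<longleftrightarrow> (\<forall>i<n. d i \<noteq> 0 \<longrightarrow> coord v $ i = 0)"
    using mat_diag_mult_vec_index[OF coord_carrier[OF v]] by auto
  finally show ?thesis .
qed

text \<open>If d i = 0, column i of P lies in the null space of A and is therefore orthogonal to the
  range of A^T. This is how the range condition on x0 - x1 is exploited.\<close>

lemma coord_row_space:
  assumes y: "y \<in> carrier_vec m" and i: "i < n" "d i = 0"
  shows "coord (G *\<^sub>v (transpose_mat A *\<^sub>v y)) $ i = 0"
proof -
  have c: "col P i \<in> carrier_vec n" using P i by auto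
  have At: "transpose_mat A \<in> carrier_mat n m" using A by simp
  have Aty: "transpose_mat A *\<^sub>v y \<in> carrier_vec n" using At y by simp
  have "col P i = P *\<^sub>v unit_vec n i" using P i by (auto intro!: eq_vecI)
  then have "coord (col P i) = unit_vec n i" using coord_P[of "unit_vec n i"] by simp
  then have "A *\<^sub>v col P i = 0\<^sub>v m" using i by (subst A_mult_eq_0_iff[OF c]) auto
  have "coord (G *\<^sub>v (transpose_mat A *\<^sub>v y)) $ i = col P i \<bullet> (transpose_mat A *\<^sub>v y)"
    using Aty P i by (simp add: coord_G)
  also have "\<dots> = (transpose_mat A *\<^sub>v y) \<bullet> col P i" using comm_scalar_prod[OF c Aty] .
  also have "\<dots> = y \<bullet> (A *\<^sub>v col P i)" using transpose_vec_mult_scalar[OF A c y] .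
  also have "\<dots> = 0" using \<open>A *\<^sub>v col P i = 0\<^sub>v m\<close> y by simp
  finally show ?thesis .
qed

text \<open>The solution set is z plus the span of the columns of P with d i = 0. The nearest point
  to x therefore takes these coordinates from x and the others from z.\<close>

lemma proj_L:
  assumes b: "z \<in> carrier_vec n" "A *\<^sub>v z = b" and x: "x \<in> carrier_vec n"
  shows "proj_L A b B x \<in> carrier_vec n" "A *\<^sub>v proj_L A b B x = b"
    "\<And>i. i < n \<Longrightarrow> d i = 0 \<Longrightarrow> coord (x - proj_L A b B x) $ i = 0"
proof -
  define s where "s = vec n (\<lambda>i. if d i = 0 then coord (x - z) $ i else 0)"
  have s: "s \<in> carrier_vec n" by (simp add: s_def)
  have Ps: "P *\<^sub>v s \<in> carrier_vec n" using P s by simp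
  define p where "p = z + P *\<^sub>v s"
  have p: "p \<in> carrier_vec n" using b Ps by (simp add: p_def)
  have bm: "b \<in> carrier_vec m" using b A by auto
  have "A *\<^sub>v (P *\<^sub>v s) = 0\<^sub>v m"
    using A_mult_eq_0_iff[OF Ps] by (simp add: coord_P[OF s]) (simp add: s_def)
  then have Ap: "A *\<^sub>v p = b"
    unfolding p_def using A b Ps bm by (simp add: mult_add_distrib_mat_vec[of _ m n])
  have coord0: "coord (x - p) $ i = 0" if i: "i < n" "d i = 0" for i
  proof -
    have "x - p = (x - z) - P *\<^sub>v s" unfolding p_def using x b P s by (intro eq_vecI) auto
    then have "coord (x - p) = coord (x - z) - s"
      using x b Ps s by (simp add: coord_diff coord_P)
    then show ?thesis using i by (simp add: s_def)
  qed
  \<comment> \<open>In each coordinate one of the two summands vanishes: y - p lives where d i = 0,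
    p - x where d i is nonzero. Minimality and uniqueness of p both follow.\<close>
  have pyth: "(\<Sum>i<n. (coord (y - x) $ i)\<^sup>2)
      = (\<Sum>i<n. (coord (y - p) $ i)\<^sup>2) + (\<Sum>i<n. (coord (p - x) $ i)\<^sup>2)"
    if y: "y \<in> carrier_vec n" "A *\<^sub>v y = b" for y
  proof -
    have "A *\<^sub>v (y - p) = 0\<^sub>v m" using A y p Ap bm by (simp add: mult_minus_distrib_mat_vec[of _ m n])
    then have z: "coord (y - p) $ i = 0" if "i < n" "d i \<noteq> 0" for i
      using A_mult_eq_0_iff[of "y - p"] y p that by auto
    have z': "coord (p - x) $ i = 0" if "i < n" "d i = 0" for i
    proof -
      have "coord x $ i - coord p $ i = 0" using coord0[OF that] that x p by (simp add: coord_diff)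
      then show ?thesis using that x p by (simp add: coord_diff)
    qed
    have "y - x = (y - p) + (p - x)" using x y p by (auto intro!: eq_vecI)
    then have "coord (y - x) = coord (y - p) + coord (p - x)" using x y p by (simp add: coord_add)
    then have "(coord (y - x) $ i)\<^sup>2 = (coord (y - p) $ i)\<^sup>2 + (coord (p - x) $ i)\<^sup>2" if "i < n" for i
      using z[OF that] z'[OF that] that x p by (cases "d i = 0") auto
    then show ?thesis by (simp add: sum.distrib)
  qed
  have sol: "p \<in> sol_set A b" using p Ap A by (simp add: sol_set_def)
  have solD: "y \<in> carrier_vec n" "A *\<^sub>v y = b" if "y \<in> sol_set A b" for y
    using that A by (auto simp: sol_set_def)
  have "proj_L A b B x = p"
    unfolding proj_L_def
  proof (rule the_equality)
    have "B_norm B (p - x) \<le> B_norm B (y - x)" if "y \<in> sol_set A b" for y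
      using solD[OF that] x p by (simp add: B_norm_eq_sqrt pyth sum_nonneg)
    with sol show "p \<in> sol_set A b \<and> (\<forall>y\<in>sol_set A b. B_norm B (p - x) \<le> B_norm B (y - x))" by blast
  next
    fix y assume y: "y \<in> sol_set A b \<and> (\<forall>u\<in>sol_set A b. B_norm B (y - x) \<le> B_norm B (u - x))"
    then have yc: "y \<in> carrier_vec n" "A *\<^sub>v y = b" using solD by auto
    have "B_norm B (y - x) \<le> B_norm B (p - x)" using y sol by blast
    then have "(\<Sum>i<n. (coord (y - p) $ i)\<^sup>2) \<le> 0"
      using yc x p by (simp add: B_norm_eq_sqrt pyth)
    then have "(\<Sum>i<n. (coord (y - p) $ i)\<^sup>2) = 0" by (intro antisym sum_nonneg) auto
    then have "coord (y - p) $ i = 0" if "i < n" for i using that by (simp add: sum_nonneg_eq_0_iff)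
    moreover have "coord (y - p) \<in> carrier_vec n" using yc p by simp
    ultimately have "coord (y - p) = 0\<^sub>v n" by (intro eq_vecI) auto
    then have yp: "y - p = 0\<^sub>v n" using coord_eq_0[of "y - p"] yc(1) p by simp
    show "y = p"
    proof (rule eq_vecI)
      fix i assume "i < dim_vec p"
      then have i: "i < n" using p by simp
      have "(y - p) $ i = 0" using i by (simp add: yp)
      then show "y $ i = p $ i" using i yc p by simp
    qed (use yc p in auto)
  qed
  then show "proj_L A b B x \<in> carrier_vec n" "A *\<^sub>v proj_L A b B x = b"
    "\<And>i. i < n \<Longrightarrow> d i = 0 \<Longrightarrow> coord (x - proj_L A b B x) $ i = 0"
    using p Ap coord0 by auto
qed

end

section \<open>Expected error of the heavy ball iterates\<close>

context sketched_system
begin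

text \<open>Consistency turns A x - b into A (x - z), so the gradient is linear in the error, with
  no noise left over at a solution. Any solution z will do; the projection is inserted only at the
  end.\<close>

lemma grad_f_eq:
  assumes z: "z \<in> carrier_vec n" "A *\<^sub>v z = b" and x: "x \<in> carrier_vec n"
  shows "grad_f A b B (sk a) x = (G * Z a) *\<^sub>v (x - z)"
proof -
  have xz: "x - z \<in> carrier_vec n" using x z by simp
  have "A *\<^sub>v x - b = A *\<^sub>v (x - z)"
    using A x z by (simp add: mult_minus_distrib_mat_vec[of _ m n])
  then have "grad_f A b B (sk a) x = G *\<^sub>v (Z a *\<^sub>v (x - z))"
    unfolding grad_f_def by (simp add: Z_mult_vec[OF xz])
  also have "\<dots> = (G * Z a) *\<^sub>v (x - z)"
    by (rule assoc_mult_mat_vec[OF G(1) Z_carrier xz, symmetric])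
  finally show ?thesis .
qed

definition step_mat :: "real \<Rightarrow> real \<Rightarrow> real mat \<Rightarrow> nat \<Rightarrow> nat \<Rightarrow> real" where
  "step_mat om be M i j = (if i = j then 1 + be else 0) - om * M $$ (i,j)"

lemma sum_step_mat:
  assumes M: "M \<in> carrier_mat n n" and r: "r \<in> carrier_vec n" and i: "i < n"
  shows "(\<Sum>l<n. step_mat om be M i l * r $ l) = (1 + be) * r $ i - om * (M *\<^sub>v r) $ i"
proof -
  have "(M *\<^sub>v r) $ i = (\<Sum>l<n. M $$ (i,l) * r $ l)"
    using M r i by (simp add: scalar_prod_def atLeast0LessThan)
  moreover have "(\<Sum>l<n. step_mat om be M i l * r $ l)
      = (\<Sum>l<n. (if i = l then (1 + be) * r $ l else 0) - om * (M $$ (i,l) * r $ l))"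
    by (intro sum.cong) (auto simp: step_mat_def algebra_simps)
  ultimately show ?thesis using i by (simp add: sum_subtractf sum_distrib_left)
qed

lemma shb_carrier:
  assumes z: "z \<in> carrier_vec n" "A *\<^sub>v z = b" and x: "x0 \<in> carrier_vec n" "x1 \<in> carrier_vec n"
  shows "shb A b B sk om be x0 x1 w k \<in> carrier_vec n"
proof (induction k rule: induct_nat_012)
  case (ge2 k)
  have "grad_f A b B (sk a) x \<in> carrier_vec n" if "x \<in> carrier_vec n" for a x
    unfolding grad_f_eq[OF z that]
    using that z by (intro mult_mat_vec_carrier[OF mult_carrier_mat[OF G(1) Z_carrier]]) simp
  then show ?case using ge2 by simp
qed (use x in auto)

text \<open>The first step of \<^const>\<open>shb\<close> uses sample 1, not sample 0, whence the shift in the stream index.\<close>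

lemma shb_error_eq_lin_rec:
  assumes z: "z \<in> carrier_vec n" "A *\<^sub>v z = b" and x: "x0 \<in> carrier_vec n" "x1 \<in> carrier_vec n"
    and i: "i < n"
  shows "(shb A b B sk om be x0 x1 w k - z) $ i
    = lin_rec n be (\<lambda>k. step_mat om be (G * Z (w !! Suc k))) (\<lambda>i. (x0 - z) $ i) (\<lambda>i. (x1 - z) $ i) k i"
  using i
proof (induction k arbitrary: i rule: induct_nat_012)
  case (ge2 k)
  let ?x = "shb A b B sk om be x0 x1 w"
  let ?M = "G * Z (w !! Suc k)"
  note xc = shb_carrier[OF z x, of om be w]
  have M: "?M \<in> carrier_mat n n" by (rule mult_carrier_mat[OF G(1) Z_carrier])
  have r: "?x (Suc k) - z \<in> carrier_vec n" using xc z by simp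
  have Mr: "?M *\<^sub>v (?x (Suc k) - z) \<in> carrier_vec n" using M r by (rule mult_mat_vec_carrier)
  have "(?x (Suc (Suc k)) - z) $ i
      = ?x (Suc k) $ i - om * (?M *\<^sub>v (?x (Suc k) - z)) $ i + be * (?x (Suc k) $ i - ?x k $ i) - z $ i"
    using ge2.prems xc[of k] xc[of "Suc k"] z(1) carrier_vecD[OF Mr]
    by (simp add: grad_f_eq[OF z xc] del: index_mult_mat_vec)
  also have "\<dots> = ((1 + be) * (?x (Suc k) - z) $ i - om * (?M *\<^sub>v (?x (Suc k) - z)) $ i)
      - be * (?x k - z) $ i"
    using ge2.prems xc[of k] xc[of "Suc k"] z(1)
    by (simp add: algebra_simps del: index_mult_mat_vec)
  also have "\<dots> = (\<Sum>l<n. step_mat om be ?M i l * (?x (Suc k) - z) $ l) - be * (?x k - z) $ i"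
    by (simp only: sum_step_mat[OF M r ge2.prems])
  also have "\<dots> = (\<Sum>l<n. step_mat om be ?M i l
        * lin_rec n be (\<lambda>k. step_mat om be (G * Z (w !! Suc k))) (\<lambda>i. (x0 - z) $ i) (\<lambda>i. (x1 - z) $ i) (Suc k) l)
      - be * lin_rec n be (\<lambda>k. step_mat om be (G * Z (w !! Suc k))) (\<lambda>i. (x0 - z) $ i) (\<lambda>i. (x1 - z) $ i) k i"
    using ge2.prems by (intro arg_cong2[of _ _ _ _ "(-)"] arg_cong2[of _ _ _ _ "(*)"] sum.cong refl ge2.IH) auto
  finally show ?case by (simp only: lin_rec.simps)
qed simp_all

lemma
  assumes ij: "i < n" "j < n"
  shows integrable_G_Z: "integrable D (\<lambda>a. (G * Z a) $$ (i,j))"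
    and integral_G_Z: "(\<integral>a. (G * Z a) $$ (i,j) \<partial>D) = (G * E) $$ (i,j)"
proof -
  have eq: "(G * Z a) $$ (i,j) = (\<Sum>l<n. G $$ (i,l) * Z a $$ (l,j))" for a
    using G(1) Z_carrier[of a] ij by (simp add: scalar_prod_def atLeast0LessThan)
  show "integrable D (\<lambda>a. (G * Z a) $$ (i,j))"
    unfolding eq using Zint ij by (intro Bochner_Integration.integrable_sum) auto
  have "(\<integral>a. (G * Z a) $$ (i,j) \<partial>D) = (\<Sum>l<n. G $$ (i,l) * E $$ (l,j))"
    unfolding eq using Zint ij by (subst Bochner_Integration.integral_sum) (auto simp: E_index)
  then show "(\<integral>a. (G * Z a) $$ (i,j) \<partial>D) = (G * E) $$ (i,j)"
    using G(1) E_carrier ij by (simp add: scalar_prod_def atLeast0LessThan)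
qed

lemma E_vec_shb_error:
  assumes z: "z \<in> carrier_vec n" "A *\<^sub>v z = b" and x: "x0 \<in> carrier_vec n" "x1 \<in> carrier_vec n"
    and i: "i < n"
  shows "E_vec D n (\<lambda>w. shb A b B sk om be x0 x1 w k - z) $ i
    = lin_rec n be (\<lambda>_. step_mat om be (G * E)) (\<lambda>i. (x0 - z) $ i) (\<lambda>i. (x1 - z) $ i) k i"
proof -
  interpret prob_space D by (rule D)
  let ?T = "\<lambda>a. step_mat om be (G * Z a)"
  let ?L = "\<lambda>T. lin_rec n be T (\<lambda>i. (x0 - z) $ i) (\<lambda>i. (x1 - z) $ i) k i"
  have T: "integrable D (\<lambda>a. ?T a i j)" if "i < n" "j < n" for i j
    unfolding step_mat_def using integrable_G_Z[OF that] by simp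
  have ET: "(\<integral>a. ?T a i j \<partial>D) = step_mat om be (G * E) i j" if "i < n" "j < n" for i j
    unfolding step_mat_def using integrable_G_Z[OF that] integral_G_Z[OF that]
    by (subst Bochner_Integration.integral_diff) (auto simp: prob_space)
  note * = expectation_lin_rec[where T = ?T, OF T i, of be "\<lambda>i. (x0 - z) $ i" "\<lambda>i. (x1 - z) $ i" k]
  have "E_vec D n (\<lambda>w. shb A b B sk om be x0 x1 w k - z) $ i
      = (\<integral>w. ?L (\<lambda>k. ?T (stl w !! k)) \<partial>stream_space D)"
    using i by (simp add: E_vec_def shb_error_eq_lin_rec[OF z x i])
  also have "\<dots> = (\<integral>w. ?L (\<lambda>k. ?T (w !! k)) \<partial>stream_space D)"
    using integral_stl[of "\<lambda>w. ?L (\<lambda>k. ?T (w !! k))"] * by blast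
  also have "\<dots> = ?L (\<lambda>_ i j. \<integral>a. ?T a i j \<partial>D)"
    using * by blast
  also have "\<dots> = ?L (\<lambda>_. step_mat om be (G * E))"
    using i by (intro lin_rec_cong) (auto simp: ET)
  finally show ?thesis .
qed

end

section \<open>Decoupling into scalar recursions and bounds on the spectrum\<close>

context diagonalized_system
begin

text \<open>The parameter conditions are stated per eigenvalue, because in eigencoordinates the mean
  recursion splits into independent scalar ones with mu = om * d i.\<close>

lemma mean_error_bound:
  assumes z: "z \<in> carrier_vec n" "A *\<^sub>v z = b" and x: "x0 \<in> carrier_vec n" "x1 \<in> carrier_vec n"
    and om: "0 < om" and be: "0 < be" "be < 1"
    and nz: "\<And>i. i < n \<Longrightarrow> d i \<noteq> 0 \<Longrightarrow> om * d i \<le> 1 \<and> (1 - sqrt (om * d i))\<^sup>2 < be"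
    and zero: "\<And>i. i < n \<Longrightarrow> d i = 0 \<Longrightarrow> coord (x0 - z) $ i = 0"
      "\<And>i. i < n \<Longrightarrow> d i = 0 \<Longrightarrow> coord (x1 - z) $ i = 0"
  shows "\<exists>C>0. \<forall>k. (B_norm B (E_vec D n (\<lambda>w. shb A b B sk om be x0 x1 w k - z)))\<^sup>2 \<le> be ^ k * C"
proof -
  define r where "r k = E_vec D n (\<lambda>w. shb A b B sk om be x0 x1 w k - z)" for k
  have r: "r k \<in> carrier_vec n" for k by (simp add: r_def E_vec_def)
  have r_index: "r k $ i = lin_rec n be (\<lambda>_. step_mat om be (G * E)) (\<lambda>i. (x0 - z) $ i) (\<lambda>i. (x1 - z) $ i) k i"
    if "i < n" for k i
    unfolding r_def by (rule E_vec_shb_error[OF z x that])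
  have r0: "r 0 = x0 - z" and r1: "r (Suc 0) = x1 - z"
    using r x z by (auto intro!: eq_vecI simp: r_index)
  have GE: "G * E \<in> carrier_mat n n" by (rule mult_carrier_mat[OF G(1) E_carrier])
  have Er: "E *\<^sub>v r k \<in> carrier_vec n" for k using E_carrier r by (rule mult_mat_vec_carrier)
  have GEr: "G *\<^sub>v (E *\<^sub>v r k) \<in> carrier_vec n" for k using G(1) Er by (rule mult_mat_vec_carrier)
  have rec: "r (Suc (Suc k)) = (1 + be) \<cdot>\<^sub>v r (Suc k) - om \<cdot>\<^sub>v (G *\<^sub>v (E *\<^sub>v r (Suc k))) - be \<cdot>\<^sub>v r k" for k
  proof (rule eq_vecI)
    fix i assume "i < dim_vec ((1 + be) \<cdot>\<^sub>v r (Suc k) - om \<cdot>\<^sub>v (G *\<^sub>v (E *\<^sub>v r (Suc k))) - be \<cdot>\<^sub>v r k)"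
    then have i: "i < n" using carrier_vecD[OF r] by simp
    have "r (Suc (Suc k)) $ i = (\<Sum>l<n. step_mat om be (G * E) i l * r (Suc k) $ l) - be * r k $ i"
      using i by (simp add: r_index)
    also have "\<dots> = (1 + be) * r (Suc k) $ i - om * (G *\<^sub>v (E *\<^sub>v r (Suc k))) $ i - be * r k $ i"
      using sum_step_mat[OF GE r i] assoc_mult_mat_vec[OF G(1) E_carrier r] by simp
    finally show "r (Suc (Suc k)) $ i
        = ((1 + be) \<cdot>\<^sub>v r (Suc k) - om \<cdot>\<^sub>v (G *\<^sub>v (E *\<^sub>v r (Suc k))) - be \<cdot>\<^sub>v r k) $ i"
      using i carrier_vecD[OF r] carrier_vecD[OF GEr] by (simp del: index_mult_mat_vec)
  qed (use carrier_vecD[OF r] in simp)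
  have coord_rec: "coord (r (Suc (Suc k))) $ i
      = (1 + be - om * d i) * coord (r (Suc k)) $ i - be * coord (r k) $ i" if i: "i < n" for k i
  proof -
    have "coord (r (Suc (Suc k)))
        = (1 + be) \<cdot>\<^sub>v coord (r (Suc k)) - om \<cdot>\<^sub>v (mat_diag n d *\<^sub>v coord (r (Suc k))) - be \<cdot>\<^sub>v coord (r k)"
      unfolding rec using r GEr Er by (simp add: coord_diff coord_smult coord_G Pt_E)
    then show ?thesis
      using i carrier_vecD[OF coord_carrier[OF r]] carrier_matD(1)[OF mat_diag_dim[of n d]]
        mat_diag_mult_vec_index[OF coord_carrier[OF r] i]
      by (simp add: algebra_simps del: index_mult_mat_vec)
  qed
  have "\<exists>C\<ge>0. \<forall>k. (coord (r k) $ i)\<^sup>2 \<le> be ^ k * C" if i: "i < n" for i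
  proof (cases "d i = 0")
    case True
    have "coord (r k) $ i = 0" for k
    proof (induction k rule: induct_nat_012)
      case (ge2 k)
      then show ?case by (simp only: coord_rec[OF i])
    qed (use zero[OF i True] in \<open>simp_all add: r0 r1\<close>)
    then show ?thesis by (intro exI[of _ 0]) simp
  next
    case False
    with d_nonneg[OF i] om have "0 < om * d i" by simp
    then show ?thesis
      using heavy_ball_scalar_bound[of "\<lambda>k. coord (r k) $ i" be "om * d i"] coord_rec[OF i] nz[OF i False] be
      by blast
  qed
  then obtain C where C: "\<And>i. i < n \<Longrightarrow> 0 \<le> C i"
    "\<And>i k. i < n \<Longrightarrow> (coord (r k) $ i)\<^sup>2 \<le> be ^ k * C i"
    by metis
  \<comment> \<open>The summand 1 keeps the constant strictly positive even when all
    \<open>C i\<close> are 0, for instance when the mean error vanishes identically.\<close>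
  have "(B_norm B (r k))\<^sup>2 \<le> be ^ k * ((\<Sum>i<n. C i) + 1)" for k
  proof -
    have "(B_norm B (r k))\<^sup>2 \<le> (\<Sum>i<n. be ^ k * C i)"
      unfolding B_norm_eq[OF r] using C by (intro sum_mono) auto
    also have "\<dots> \<le> be ^ k * ((\<Sum>i<n. C i) + 1)"
      using be by (simp add: sum_distrib_left algebra_simps)
    finally show ?thesis .
  qed
  moreover have "0 < (\<Sum>i<n. C i) + 1" using sum_nonneg[of "{..<n}" C] C(1) by force
  ultimately show ?thesis unfolding r_def by blast
qed

lemma lambda_bounds:
  assumes Anz: "A \<noteq> 0\<^sub>m m n"
  shows "0 < lambda_min_pos W" "lambda_min_pos W \<le> lambda_max W" "lambda_max W \<le> 1"
    "\<And>i. i < n \<Longrightarrow> d i \<noteq> 0 \<Longrightarrow> lambda_min_pos W \<le> d i" "\<And>i. i < n \<Longrightarrow> d i \<le> lambda_max W"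
proof -
  let ?N = "{k \<in> d ` {..<n}. k \<noteq> 0}"
  have "{k. eigenvalue W k \<and> k \<noteq> 0} = ?N" using eigenvalues_W by blast
  then have min: "lambda_min_pos W = Min ?N" by (simp add: lambda_min_pos_def)
  have max: "lambda_max W = Max (d ` {..<n})" by (simp add: lambda_max_def eigenvalues_W)
  \<comment> \<open>If every d i were 0, A would annihilate every vector and in particular have zero
    columns. This nonemptiness is what makes \<open>Min\<close> and \<open>Max\<close>
    meaningful.\<close>
  have "\<exists>i<n. d i \<noteq> 0"
  proof (rule ccontr)
    assume "\<not> ?thesis"
    then have Av: "A *\<^sub>v v = 0\<^sub>v m" if "v \<in> carrier_vec n" for v using A_mult_eq_0_iff[OF that] by auto
    have "A = 0\<^sub>m m n"
    proof (rule eq_matI)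
      fix i j assume "i < dim_row (0\<^sub>m m n :: real mat)" "j < dim_col (0\<^sub>m m n :: real mat)"
      then have ij: "i < m" "j < n" by auto
      have "A $$ (i,j) = (A *\<^sub>v unit_vec n j) $ i" using A ij by simp
      then show "A $$ (i,j) = 0\<^sub>m m n $$ (i,j)" using ij by (simp add: Av del: index_mult_mat_vec)
    qed (use A in auto)
    then show False using Anz by simp
  qed
  then have ne: "?N \<noteq> {}" by auto
  have fin: "finite ?N" by simp
  show "0 < lambda_min_pos W" unfolding min using ne d_nonneg by (subst Min_gr_iff) (auto simp: less_le)
  show le: "d i \<le> lambda_max W" if "i < n" for i unfolding max using that by simp
  show "lambda_min_pos W \<le> d i" if "i < n" "d i \<noteq> 0" for i unfolding min using that by (intro Min_le) auto
  have "Min ?N \<in> ?N" using fin ne by (rule Min_in)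
  then show "lambda_min_pos W \<le> lambda_max W" unfolding min using le by auto
  show "lambda_max W \<le> 1" unfolding max using ne d_le_1 by (subst Max_le_iff) auto
qed

end

text \<open>Here q stands for om * lambda_min_pos, which is lambda_min_pos in choice (i) and
  lambda_min_pos / lambda_max in choice (ii). The factor 0.99 < 1 buys the strict inequality, and q
  <= 1 keeps the squared quantities nonnegative.\<close>

lemma one_minus_sqrt_99_percent:
  assumes "0 < q" "q \<le> (1 :: real)"
  shows "(1 - sqrt q)\<^sup>2 < (1 - sqrt (0.99 * q))\<^sup>2" "(1 - sqrt (0.99 * q))\<^sup>2 < 1"
proof -
  have *: "sqrt (0.99 * q) < sqrt q" "0 < sqrt (0.99 * q)" "sqrt q \<le> 1" using assms by auto
  then show "(1 - sqrt q)\<^sup>2 < (1 - sqrt (0.99 * q))\<^sup>2" by (intro power_strict_mono) auto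
  have "(1 - sqrt (0.99 * q))\<^sup>2 < 1\<^sup>2" using * by (intro power_strict_mono) auto
  then show "(1 - sqrt (0.99 * q))\<^sup>2 < 1" by simp
qed

theorem mainTheorem4:
  fixes A B :: "real mat" and b x0 x1 :: "real vec" and m n :: nat
    and D :: "'a measure" and sk :: "'a \<Rightarrow> real mat"
  assumes A: "A \<in> carrier_mat m n" and bdim: "b \<in> carrier_vec m"
    and consistent: "\<exists>x \<in> carrier_vec n. A *\<^sub>v x = b"
    and Bdim: "B \<in> carrier_mat n n" and Bpd: "pos_def B"
    and D: "prob_space D"
    and skdim: "\<And>a. dim_row (sk a) = m"
    and Zint: "\<And>i j. i < n \<Longrightarrow> j < n \<Longrightarrow> integrable D (\<lambda>a. Z_mat A B (sk a) $$ (i,j))"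
    and exact: "mat_kernel (EZ A B D sk) = mat_kernel A"
    and Anz: "A \<noteq> 0\<^sub>m m n"
    and x0: "x0 \<in> carrier_vec n" and x1: "x1 \<in> carrier_vec n"
    and range: "\<exists>y \<in> carrier_vec m. x0 - x1 = mat_inv B *\<^sub>v (transpose_mat A *\<^sub>v y)"
  shows "(\<forall>om beta. good_params (lambda_max (W_mat A B D sk)) (lambda_min_pos (W_mat A B D sk)) om beta \<longrightarrow>
            (\<exists>C > 0. \<forall>k. (B_norm B (E_vec D n (\<lambda>w. shb A b B sk om beta x0 x1 w k - proj_L A b B x0)))^2
                         \<le> beta ^ k * C))
       \<and> good_params (lambda_max (W_mat A B D sk)) (lambda_min_pos (W_mat A B D sk))
            1 ((1 - sqrt (0.99 * lambda_min_pos (W_mat A B D sk)))^2)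
       \<and> good_params (lambda_max (W_mat A B D sk)) (lambda_min_pos (W_mat A B D sk))
            (1 / lambda_max (W_mat A B D sk))
            ((1 - sqrt (0.99 * lambda_min_pos (W_mat A B D sk) / lambda_max (W_mat A B D sk)))^2)"
proof -
  interpret sketched_system A B m n D sk
    by (rule sketched_system.intro; fact)
  obtain P d where Pd: "P \<in> carrier_mat n n" "transpose_mat P * B * P = 1\<^sub>m n"
    "P * transpose_mat P = G" "transpose_mat P * E * P = mat_diag n d"
    "{k. eigenvalue W k} = d ` {..<n}" "\<And>i. i < n \<Longrightarrow> 0 \<le> d i" "\<And>i. i < n \<Longrightarrow> d i \<le> 1"
    using simultaneous_diagonalization by blast
  interpret diagonalized_system A B m n D sk P d
    by unfold_locales (fact Pd)+
  note lam = lambda_bounds[OF Anz]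
  obtain z where z: "z \<in> carrier_vec n" "A *\<^sub>v z = b" using consistent by blast
  obtain y where y: "y \<in> carrier_vec m" "x0 - x1 = mat_inv B *\<^sub>v (transpose_mat A *\<^sub>v y)"
    using range by blast
  let ?p = "proj_L A b B x0"
  note p = proj_L[OF z x0]
  \<comment> \<open>The null coordinates of x0 - p vanish by the choice of p, and those of x0 - x1
    by the range condition; so both starting errors lie in the subspace where the recursion
    contracts.\<close>
  have zero: "coord (x1 - ?p) $ i = 0" if i: "i < n" "d i = 0" for i
  proof -
    have "x1 - ?p = (x0 - ?p) - (x0 - x1)" using x0 x1 p(1) by (auto intro!: eq_vecI)
    then have "coord (x1 - ?p) = coord (x0 - ?p) - coord (x0 - x1)"
      using x0 x1 p(1) by (simp only: coord_diff minus_carrier_vec)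
    moreover have "coord (x0 - x1) $ i = 0" unfolding y(2) by (rule coord_row_space[OF y(1) i])
    moreover have "coord (x0 - x1) \<in> carrier_vec n" using x0 x1 by simp
    ultimately show ?thesis using p(3)[OF i] i(1) by simp
  qed
  have "\<exists>C>0. \<forall>k. (B_norm B (E_vec D n (\<lambda>w. shb A b B sk om be x0 x1 w k - ?p)))\<^sup>2 \<le> be ^ k * C"
    if good: "good_params (lambda_max W) (lambda_min_pos W) om be" for om be
  proof (rule mean_error_bound[OF p(1,2) x0 x1 _ _ _ _ p(3) zero])
    show om: "0 < om" "be < 1" using good by (auto simp: good_params_def)
    have be: "(1 - sqrt (om * lambda_min_pos W))\<^sup>2 < be" using good by (simp add: good_params_def)
    then show "0 < be" using zero_le_power2[of "1 - sqrt (om * lambda_min_pos W)"] by linarith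
    have omax: "om * lambda_max W \<le> 1" using good lam by (simp add: good_params_def pos_le_divide_eq)
    fix i assume i: "i < n" "d i \<noteq> 0"
    have "om * d i \<le> om * lambda_max W" using lam(5)[OF i(1)] om by simp
    then have le1: "om * d i \<le> 1" using omax by linarith
    have "om * lambda_min_pos W \<le> om * d i" using lam(4)[OF i] om by simp
    \<comment> \<open>om * d i <= 1 keeps 1 - sqrt (om * d i) nonnegative, so squaring preserves the
      order and the smallest nonzero eigenvalue is the worst case.\<close>
    then have "(1 - sqrt (om * d i))\<^sup>2 \<le> (1 - sqrt (om * lambda_min_pos W))\<^sup>2"
      using le1 by (intro power_mono) auto
    with be le1 show "om * d i \<le> 1 \<and> (1 - sqrt (om * d i))\<^sup>2 < be" by linarith
  qed
  moreover have "good_params (lambda_max W) (lambda_min_pos W) 1 ((1 - sqrt (0.99 * lambda_min_pos W))\<^sup>2)"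
    using lam(1-3) one_minus_sqrt_99_percent[of "lambda_min_pos W"] by (simp add: good_params_def pos_le_divide_eq)
  moreover have "good_params (lambda_max W) (lambda_min_pos W) (1 / lambda_max W)
      ((1 - sqrt (0.99 * lambda_min_pos W / lambda_max W))\<^sup>2)"
    using lam(1-3) one_minus_sqrt_99_percent[of "lambda_min_pos W / lambda_max W"] by (simp add: good_params_def)
  ultimately show ?thesis by blast
qed

end
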